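(* Let $(M,\varphi,\xi,\eta,g)$ be a $(2n+1)$-dimensional para-Sasaki-like Riemannian manifold, let $\alpha,\beta$ be constants, and let $\overline{\nabla}$ be the generalized symmetric metric connection on $M$ determined by $\alpha,\beta$. If $(M,\varphi,\xi,\eta,g)$ admits a para-Ricci-like soliton with potential $\xi$ and constants $(a,b,c)$, then $(M,\varphi,\xi,\eta,g)$ with the connection $\overline{\nabla}$ also admits a para-Ricci-like soliton (with potential $\xi$), that is, $\frac12\overline{\mathcal{L}}_\xi g+\overline{\mathrm{Ric}}+\lambda g+\mu\widetilde{g}+\nu\,\eta\otimes\eta=0$, with constants $(\lambda,\mu,\nu)$ determined by $$\begin{aligned} \lambda&=(2n-1)\alpha^2-\beta^2+\alpha+\beta+a,\\ \mu&=2(n-1)\alpha\beta+(1-2n)\alpha+\beta+b,\\ \nu&=\beta^2+(1-2n)\alpha^2+(\alpha-\alpha\beta)(2n-2)-(2n+2)\beta+c. \end{aligned}$$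
   Context: An almost paracontact almost paracomplex Riemannian manifold (apapR manifold) $(M,\varphi,\xi,\eta,g)$ is a differentiable manifold $M$ of dimension $2n+1$ with a $(1,1)$-tensor field $\varphi$, a vector field $\xi$, a $1$-form $\eta$ and a Riemannian metric $g$ such that, for all vector fields $x,y$: $\eta(\xi)=1$, $\varphi^2x=x-\eta(x)\xi$, $\varphi\xi=0$, $g(\varphi x,\varphi y)=g(x,y)-\eta(x)\eta(y)$, $\mathrm{tr}\,\varphi=0$. Consequently $g(x,\xi)=\eta(x)$ and $g(x,\varphi y)=g(\varphi x,y)$. The associated metric is $\widetilde{g}(x,y)=g(x,\varphi y)+\eta(x)\eta(y)$. With $\nabla$ the Levi-Civita connection of $g$, the apapR manifold is called para-Sasaki-like if $(\nabla_x\varphi)y=-g(x,y)\xi-\eta(y)x+2\eta(x)\eta(y)\xi$ for all vector fields $x,y$. The generalized symmetric metric connection determined by $\alpha,\beta$ is $$\overline{\nabla}_xy=\nabla_xy+\alpha\{g(x,y)\xi-\eta(y)x\}+\beta\{g(\varphi x,y)\xi-\eta(y)\varphi x\}.$$ Conventions: $\overline{R}(x,y)z=\overline{\nabla}_x\overline{\nabla}_yz-\overline{\nabla}_y\overline{\nabla}_xz-\overline{\nabla}_{[x,y]}z$, $\overline{R}(x,y,z,w)=g(\overline{R}(x,y)z,w)$, and $\overline{\mathrm{Ric}}(x,y)=\sum_{i=0}^{2n}\overline{R}(e_i,x,y,e_i)$ for an orthonormal basis $\{e_0=\xi,e_1,\ldots,e_{2n}\}$ of the tangent space; likewise $R$ and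 $\mathrm{Ric}$ with $\nabla$. The Lie derivative of $g$ along $\xi$ is $(\mathcal{L}_\xi g)(x,y)=g(\nabla_x\xi,y)+g(x,\nabla_y\xi)$, and its analogue for $\overline{\nabla}$ is $(\overline{\mathcal{L}}_\xi g)(x,y)=g(\overline{\nabla}_x\xi,y)+g(x,\overline{\nabla}_y\xi)$. The manifold admits a para-Ricci-like soliton with potential $\xi$ and constants $(a,b,c)$ if $\frac12\mathcal{L}_\xi g+\mathrm{Ric}+a\,g+b\,\widetilde{g}+c\,\eta\otimes\eta=0$, where $a,b,c$ are constants. *)

theory Defs
  imports "HOL-Analysis.Analysis" "HOL-Library.Function_Algebras"
begin

section \<open>Linear algebra preliminaries\<close>

text \<open>Tangent vectors are real functionals, so their spaces are real vector spaces pointwise.\<close>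

instantiation "fun" :: (type, real_vector) real_vector
begin

definition scaleR_fun_def: "r *\<^sub>R f = (\<lambda>x. r *\<^sub>R f x)"

instance
  by standard (simp_all add: scaleR_fun_def plus_fun_def fun_eq_iff scaleR_add_left scaleR_add_right)

end

definition linear_map_on :: "'a::real_vector set \<Rightarrow> ('a \<Rightarrow> 'b::real_vector) \<Rightarrow> bool" where
  "linear_map_on V T \<longleftrightarrow>
     (\<forall>u\<in>V. \<forall>v\<in>V. T (u + v) = T u + T v) \<and> (\<forall>r. \<forall>u\<in>V. T (r *\<^sub>R u) = r *\<^sub>R T u)"

text \<open>Trace of an endomorphism of a finite-dimensional subspace \<open>V\<close>, computed in some basis
  of \<open>V\<close>.\<close>

definition trace_on :: "'a::real_vector set \<Rightarrow> ('a \<Rightarrow> 'a) \<Rightarrow> real" where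
  "trace_on V T =
     (let B = (SOME B. independent B \<and> span B = V) in \<Sum>b\<in>B. representation B (T b) b)"


section \<open>Smooth manifolds\<close>

text \<open>\<open>C\<^sup>k\<close> maps between Euclidean spaces; only used on open sets.\<close>

primrec Ck_on :: "nat \<Rightarrow> 'a::euclidean_space set \<Rightarrow> ('a \<Rightarrow> 'b::real_normed_vector) \<Rightarrow> bool" where
  "Ck_on 0 S f \<longleftrightarrow> continuous_on S f"
| "Ck_on (Suc k) S f \<longleftrightarrow>
     (\<forall>x\<in>S. f differentiable (at x)) \<and> (\<forall>v. Ck_on k S (\<lambda>x. frechet_derivative f (at x) v))"

definition smooth_on :: "'a::euclidean_space set \<Rightarrow> ('a \<Rightarrow> 'b::real_normed_vector) \<Rightarrow> bool" where
  "smooth_on S f \<longleftrightarrow> (\<forall>k. Ck_on k S f)"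

type_synonym ('m, 'e) chart = "'m set \<times> ('m \<Rightarrow> 'e)"

text \<open>The manifold is the whole type \<open>'m\<close>, modelled on the Euclidean space \<open>'e\<close>. The Hausdorff
  and second countability axioms are imposed through the type class of \<open>'m\<close>.\<close>

definition smooth_atlas :: "('m::topological_space, 'e::euclidean_space) chart set \<Rightarrow> bool" where
  "smooth_atlas A \<longleftrightarrow>
     (\<Union>(U, \<psi>)\<in>A. U) = UNIV \<and>
     (\<forall>(U, \<psi>)\<in>A. open U \<and> open (\<psi> ` U) \<and> homeomorphism U (\<psi> ` U) \<psi> (inv_into U \<psi>)) \<and>
     (\<forall>(U, \<psi>)\<in>A. \<forall>(V, \<theta>)\<in>A. smooth_on (\<psi> ` (U \<inter> V)) (\<theta> \<circ> inv_into U \<psi>))"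

definition smooth_functions :: "('m, 'e::euclidean_space) chart set \<Rightarrow> ('m \<Rightarrow> real) set" where
  "smooth_functions A = {f. \<forall>(U, \<psi>)\<in>A. smooth_on (\<psi> ` U) (f \<circ> inv_into U \<psi>)}"

type_synonym 'm tangent_vector = "('m \<Rightarrow> real) \<Rightarrow> real"
type_synonym 'm vector_field = "'m \<Rightarrow> 'm tangent_vector"

text \<open>Tangent vectors at \<open>p\<close> are the derivations at \<open>p\<close> of the algebra of smooth functions. They
  are made \<open>0\<close> on non-smooth arguments, so that equality of tangent vectors is equality in HOL.\<close>

definition tangent_space ::
  "('m, 'e::euclidean_space) chart set \<Rightarrow> 'm \<Rightarrow> 'm tangent_vector set" where
  "tangent_space A p =
     {v. linear_map_on (smooth_functions A) v \<and>
         (\<forall>f\<in>smooth_functions A. \<forall>h\<in>smooth_functions A. v (f * h) = f p * v h + h p * v f) \<and>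
         (\<forall>f. f \<notin> smooth_functions A \<longrightarrow> v f = 0)}"

definition vector_fields :: "('m, 'e::euclidean_space) chart set \<Rightarrow> 'm vector_field set" where
  "vector_fields A =
     {X. (\<forall>p. X p \<in> tangent_space A p) \<and>
         (\<forall>f\<in>smooth_functions A. (\<lambda>p. X p f) \<in> smooth_functions A)}"

definition lie_bracket :: "'m vector_field \<Rightarrow> 'm vector_field \<Rightarrow> 'm vector_field" where
  "lie_bracket X Y = (\<lambda>p f. X p (\<lambda>q. Y q f) - Y p (\<lambda>q. X q f))"


section \<open>Tensor fields and connections\<close>

text \<open>A family of multilinear maps on the tangent spaces is a smooth tensor field iff it maps
  smooth vector fields to smooth functions or smooth vector fields, respectively.\<close>

definition one_form ::
  "('m, 'e::euclidean_space) chart set \<Rightarrow> ('m \<Rightarrow> 'm tangent_vector \<Rightarrow> real) \<Rightarrow> bool" where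
  "one_form A \<eta> \<longleftrightarrow>
     (\<forall>p. linear_map_on (tangent_space A p) (\<eta> p)) \<and>
     (\<forall>X\<in>vector_fields A. (\<lambda>p. \<eta> p (X p)) \<in> smooth_functions A)"

definition endomorphism_field ::
  "('m, 'e::euclidean_space) chart set \<Rightarrow> ('m \<Rightarrow> 'm tangent_vector \<Rightarrow> 'm tangent_vector) \<Rightarrow> bool"
where
  "endomorphism_field A \<phi> \<longleftrightarrow>
     (\<forall>p. linear_map_on (tangent_space A p) (\<phi> p) \<and>
          \<phi> p ` tangent_space A p \<subseteq> tangent_space A p) \<and>
     (\<forall>X\<in>vector_fields A. (\<lambda>p. \<phi> p (X p)) \<in> vector_fields A)"

definition riemannian_metric ::
  "('m, 'e::euclidean_space) chart set \<Rightarrow>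
   ('m \<Rightarrow> 'm tangent_vector \<Rightarrow> 'm tangent_vector \<Rightarrow> real) \<Rightarrow> bool"
where
  "riemannian_metric A g \<longleftrightarrow>
     (\<forall>p. \<forall>u\<in>tangent_space A p.
        linear_map_on (tangent_space A p) (g p u) \<and>
        (\<forall>v\<in>tangent_space A p. g p u v = g p v u) \<and>
        (u \<noteq> 0 \<longrightarrow> g p u u > 0)) \<and>
     (\<forall>X\<in>vector_fields A. \<forall>Y\<in>vector_fields A. (\<lambda>p. g p (X p) (Y p)) \<in> smooth_functions A)"

type_synonym 'm connection = "'m vector_field \<Rightarrow> 'm vector_field \<Rightarrow> 'm vector_field"

text \<open>\<open>D X Y\<close> is the covariant derivative of \<open>Y\<close> in direction \<open>X\<close>; its values are
  relevant only for smooth vector fields.\<close>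

definition affine_connection ::
  "('m, 'e::euclidean_space) chart set \<Rightarrow> 'm connection \<Rightarrow> bool" where
  "affine_connection A D \<longleftrightarrow>
     (\<forall>X\<in>vector_fields A. \<forall>Y\<in>vector_fields A. D X Y \<in> vector_fields A) \<and>
     (\<forall>X\<in>vector_fields A. \<forall>Y\<in>vector_fields A. \<forall>Z\<in>vector_fields A.
        D (X + Y) Z = D X Z + D Y Z \<and> D X (Y + Z) = D X Y + D X Z) \<and>
     (\<forall>f\<in>smooth_functions A. \<forall>X\<in>vector_fields A. \<forall>Y\<in>vector_fields A.
        D (\<lambda>p. f p *\<^sub>R X p) Y = (\<lambda>p. f p *\<^sub>R D X Y p) \<and>
        D X (\<lambda>p. f p *\<^sub>R Y p) = (\<lambda>p. X p f *\<^sub>R Y p + f p *\<^sub>R D X Y p))"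

definition levi_civita_connection ::
  "('m, 'e::euclidean_space) chart set \<Rightarrow>
   ('m \<Rightarrow> 'm tangent_vector \<Rightarrow> 'm tangent_vector \<Rightarrow> real) \<Rightarrow> 'm connection \<Rightarrow> bool"
where
  "levi_civita_connection A g D \<longleftrightarrow>
     affine_connection A D \<and>
     (\<forall>X\<in>vector_fields A. \<forall>Y\<in>vector_fields A. D X Y - D Y X = lie_bracket X Y) \<and>
     (\<forall>X\<in>vector_fields A. \<forall>Y\<in>vector_fields A. \<forall>Z\<in>vector_fields A. \<forall>p.
        X p (\<lambda>q. g q (Y q) (Z q)) = g p (D X Y p) (Z p) + g p (Y p) (D X Z p))"

definition curvature ::
  "'m connection \<Rightarrow> 'm vector_field \<Rightarrow> 'm vector_field \<Rightarrow> 'm vector_field \<Rightarrow> 'm vector_field"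
where
  "curvature D X Y Z = D X (D Y Z) - D Y (D X Z) - D (lie_bracket X Y) Z"

definition curvature_tensor ::
  "('m \<Rightarrow> 'm tangent_vector \<Rightarrow> 'm tangent_vector \<Rightarrow> real) \<Rightarrow> 'm connection \<Rightarrow>
   'm vector_field \<Rightarrow> 'm vector_field \<Rightarrow> 'm vector_field \<Rightarrow> 'm vector_field \<Rightarrow> 'm \<Rightarrow> real"
where
  "curvature_tensor g D X Y Z W = (\<lambda>p. g p (curvature D X Y Z p) (W p))"


section \<open>Almost paracontact almost paracomplex Riemannian manifolds\<close>

definition apapR_manifold ::
  "nat \<Rightarrow> ('m::{t2_space, second_countable_topology}, 'e::euclidean_space) chart set \<Rightarrow>
   ('m \<Rightarrow> 'm tangent_vector \<Rightarrow> 'm tangent_vector) \<Rightarrow> 'm vector_field \<Rightarrow>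
   ('m \<Rightarrow> 'm tangent_vector \<Rightarrow> real) \<Rightarrow>
   ('m \<Rightarrow> 'm tangent_vector \<Rightarrow> 'm tangent_vector \<Rightarrow> real) \<Rightarrow> bool"
where
  "apapR_manifold n A \<phi> \<xi> \<eta> g \<longleftrightarrow>
     smooth_atlas A \<and> DIM('e) = 2 * n + 1 \<and>
     endomorphism_field A \<phi> \<and> \<xi> \<in> vector_fields A \<and> one_form A \<eta> \<and> riemannian_metric A g \<and>
     (\<forall>p. \<eta> p (\<xi> p) = 1 \<and> \<phi> p (\<xi> p) = 0 \<and> trace_on (tangent_space A p) (\<phi> p) = 0 \<and>
       (\<forall>x\<in>tangent_space A p. \<phi> p (\<phi> p x) = x - \<eta> p x *\<^sub>R \<xi> p) \<and>
       (\<forall>x\<in>tangent_space A p. \<forall>y\<in>tangent_space A p.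
          g p (\<phi> p x) (\<phi> p y) = g p x y - \<eta> p x * \<eta> p y))"

definition associated_metric ::
  "('m \<Rightarrow> 'm tangent_vector \<Rightarrow> 'm tangent_vector) \<Rightarrow> ('m \<Rightarrow> 'm tangent_vector \<Rightarrow> real) \<Rightarrow>
   ('m \<Rightarrow> 'm tangent_vector \<Rightarrow> 'm tangent_vector \<Rightarrow> real) \<Rightarrow>
   'm \<Rightarrow> 'm tangent_vector \<Rightarrow> 'm tangent_vector \<Rightarrow> real"
where
  "associated_metric \<phi> \<eta> g p x y = g p x (\<phi> p y) + \<eta> p x * \<eta> p y"

text \<open>\<open>(\<nabla>\<^sub>X \<phi>) Y = \<nabla>\<^sub>X (\<phi> Y) - \<phi> (\<nabla>\<^sub>X Y)\<close>\<close>

definition covariant_derivative_endo ::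
  "'m connection \<Rightarrow> ('m \<Rightarrow> 'm tangent_vector \<Rightarrow> 'm tangent_vector) \<Rightarrow>
   'm vector_field \<Rightarrow> 'm vector_field \<Rightarrow> 'm vector_field"
where
  "covariant_derivative_endo D \<phi> X Y = (\<lambda>p. D X (\<lambda>q. \<phi> q (Y q)) p - \<phi> p (D X Y p))"

text \<open>Here \<open>D\<close> is meant to be the Levi-Civita connection of \<open>g\<close>.\<close>

definition para_Sasaki_like ::
  "nat \<Rightarrow> ('m::{t2_space, second_countable_topology}, 'e::euclidean_space) chart set \<Rightarrow>
   ('m \<Rightarrow> 'm tangent_vector \<Rightarrow> 'm tangent_vector) \<Rightarrow> 'm vector_field \<Rightarrow>
   ('m \<Rightarrow> 'm tangent_vector \<Rightarrow> real) \<Rightarrow>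
   ('m \<Rightarrow> 'm tangent_vector \<Rightarrow> 'm tangent_vector \<Rightarrow> real) \<Rightarrow> 'm connection \<Rightarrow> bool"
where
  "para_Sasaki_like n A \<phi> \<xi> \<eta> g D \<longleftrightarrow>
     apapR_manifold n A \<phi> \<xi> \<eta> g \<and>
     (\<forall>X\<in>vector_fields A. \<forall>Y\<in>vector_fields A. \<forall>p.
        covariant_derivative_endo D \<phi> X Y p =
          - (g p (X p) (Y p) *\<^sub>R \<xi> p) - \<eta> p (Y p) *\<^sub>R X p
          + (2 * \<eta> p (X p) * \<eta> p (Y p)) *\<^sub>R \<xi> p)"

definition generalized_symmetric_connection ::
  "('m \<Rightarrow> 'm tangent_vector \<Rightarrow> 'm tangent_vector) \<Rightarrow> 'm vector_field \<Rightarrow>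
   ('m \<Rightarrow> 'm tangent_vector \<Rightarrow> real) \<Rightarrow>
   ('m \<Rightarrow> 'm tangent_vector \<Rightarrow> 'm tangent_vector \<Rightarrow> real) \<Rightarrow> 'm connection \<Rightarrow>
   real \<Rightarrow> real \<Rightarrow> 'm connection"
where
  "generalized_symmetric_connection \<phi> \<xi> \<eta> g D \<alpha> \<beta> X Y =
     (\<lambda>p. D X Y p
        + \<alpha> *\<^sub>R (g p (X p) (Y p) *\<^sub>R \<xi> p - \<eta> p (Y p) *\<^sub>R X p)
        + \<beta> *\<^sub>R (g p (\<phi> p (X p)) (Y p) *\<^sub>R \<xi> p - \<eta> p (Y p) *\<^sub>R \<phi> p (X p)))"


section \<open>Ricci tensor and para-Ricci-like solitons\<close>

definition adapted_orthonormal_basis ::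
  "nat \<Rightarrow> ('m, 'e::euclidean_space) chart set \<Rightarrow> 'm vector_field \<Rightarrow>
   ('m \<Rightarrow> 'm tangent_vector \<Rightarrow> 'm tangent_vector \<Rightarrow> real) \<Rightarrow> 'm \<Rightarrow>
   (nat \<Rightarrow> 'm tangent_vector) \<Rightarrow> bool"
where
  "adapted_orthonormal_basis n A \<xi> g p e \<longleftrightarrow>
     e 0 = \<xi> p \<and> e ` {0..2 * n} \<subseteq> tangent_space A p \<and> span (e ` {0..2 * n}) = tangent_space A p \<and>
     (\<forall>i\<in>{0..2 * n}. \<forall>j\<in>{0..2 * n}. g p (e i) (e j) = (if i = j then 1 else 0))"

definition extension ::
  "('m, 'e::euclidean_space) chart set \<Rightarrow> 'm \<Rightarrow> 'm tangent_vector \<Rightarrow> 'm vector_field" where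
  "extension A p u = (SOME X. X \<in> vector_fields A \<and> X p = u)"

text \<open>For a connection \<open>D\<close> the curvature is tensorial, so its value at \<open>p\<close> on tangent vectors at
  \<open>p\<close> is obtained by extending these to vector fields; neither the choice of the extensions nor
  that of the orthonormal basis matters.\<close>

definition ricci ::
  "nat \<Rightarrow> ('m, 'e::euclidean_space) chart set \<Rightarrow> 'm vector_field \<Rightarrow>
   ('m \<Rightarrow> 'm tangent_vector \<Rightarrow> 'm tangent_vector \<Rightarrow> real) \<Rightarrow> 'm connection \<Rightarrow>
   'm vector_field \<Rightarrow> 'm vector_field \<Rightarrow> 'm \<Rightarrow> real"
where
  "ricci n A \<xi> g D X Y p =
     (let e = (SOME e. adapted_orthonormal_basis n A \<xi> g p e)
      in \<Sum>i = 0..2 * n. curvature_tensor g D (extension A p (e i)) X Y (extension A p (e i)) p)"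

text \<open>\<open>(\<L>\<^sub>\<xi> g)(X, Y)\<close> written through a connection; it is the usual Lie derivative when
  \<open>D\<close> is the Levi-Civita connection.\<close>

definition lie_derivative_metric ::
  "'m vector_field \<Rightarrow> ('m \<Rightarrow> 'm tangent_vector \<Rightarrow> 'm tangent_vector \<Rightarrow> real) \<Rightarrow>
   'm connection \<Rightarrow> 'm vector_field \<Rightarrow> 'm vector_field \<Rightarrow> 'm \<Rightarrow> real"
where
  "lie_derivative_metric \<xi> g D X Y p = g p (D X \<xi> p) (Y p) + g p (X p) (D Y \<xi> p)"

definition para_Ricci_like_soliton ::
  "nat \<Rightarrow> ('m, 'e::euclidean_space) chart set \<Rightarrow>
   ('m \<Rightarrow> 'm tangent_vector \<Rightarrow> 'm tangent_vector) \<Rightarrow> 'm vector_field \<Rightarrow>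
   ('m \<Rightarrow> 'm tangent_vector \<Rightarrow> real) \<Rightarrow>
   ('m \<Rightarrow> 'm tangent_vector \<Rightarrow> 'm tangent_vector \<Rightarrow> real) \<Rightarrow> 'm connection \<Rightarrow>
   real \<Rightarrow> real \<Rightarrow> real \<Rightarrow> bool"
where
  "para_Ricci_like_soliton n A \<phi> \<xi> \<eta> g D a b c \<longleftrightarrow>
     (\<forall>X\<in>vector_fields A. \<forall>Y\<in>vector_fields A. \<forall>p.
        (1 / 2) * lie_derivative_metric \<xi> g D X Y p + ricci n A \<xi> g D X Y p
        + a * g p (X p) (Y p) + b * associated_metric \<phi> \<eta> g p (X p) (Y p)
        + c * (\<eta> p (X p) * \<eta> p (Y p)) = 0)"

end

theory Submission
  imports Defs
begin

text \<open>Put \<open>P = \<alpha> id + \<beta> \<phi>\<close>. The new connection is the Levi-Civita connection \<open>D\<close> plus the tensor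
  \<open>S(x, y) = g(P x, y) \<xi> - \<eta>(y) P x\<close>, so its curvature differs from that of \<open>D\<close> by
  \<open>(D\<^sub>x S)(y, z) - (D\<^sub>y S)(x, z) + S(x, S(y, z)) - S(y, S(x, z))\<close>. The para-Sasaki-like condition
  forces \<open>D\<^sub>x \<xi> = \<phi> x\<close>, hence this difference is algebraic in \<open>g\<close>, \<open>\<phi>\<close>, \<open>\<eta>\<close>, and its trace
  over an orthonormal frame is a combination of \<open>g(y, z)\<close>, \<open>g(y, \<phi> z)\<close> and \<open>\<eta>(y) \<eta>(z)\<close> because
  \<open>tr \<phi> = 0\<close>. The Lie derivative changes by a combination of the same three terms.

  Since tangent vectors are derivations of the global smooth functions, the existence of a frame
  with \<open>2 n + 1\<close> elements and of extensions to vector fields rests on cutoff functions and on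
  Hadamard's lemma.\<close>

section \<open>Calculus of smooth maps\<close>

text \<open>\<open>ricci\<close> picks its frame and the extensions of the frame vectors by
  \<open>SOME\<close>, so each has to be exhibited before \<open>ricci\<close> can be evaluated.
  These choices do not mention the connection: the Ricci sums of both connections run over the same
  frame and the same extensions and are subtracted term by term, so the Ricci tensor of
  \<open>D\<close> itself is never computed. \<open>trace_on\<close> uses a third choice, a basis
  unrelated to the frame, so tr \<phi> = 0 has to be carried over to the frame first. The dimension
  enters the constants only by counting: summands that become independent of the frame vector
  through g(e, e) = 1 occur 2 n + 1 times.\<close>

lemma Ck_on_Suc_imp_Ck_on: "Ck_on (Suc k) S f \<Longrightarrow> Ck_on k S f"
proof (induction k arbitrary: f)
  case 0
  then show ?case
    by (auto intro!: continuous_at_imp_continuous_on differentiable_imp_continuous_within)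
next
  case (Suc k)
  have "Ck_on k S (\<lambda>x. frechet_derivative f (at x) v)" for v
    using Suc.prems by (rule_tac Suc.IH) simp
  then show ?case using Suc.prems by simp
qed

lemma Ck_on_subset: "Ck_on k S f \<Longrightarrow> T \<subseteq> S \<Longrightarrow> Ck_on k T f"
  by (induction k arbitrary: f) (auto intro: continuous_on_subset)

text \<open>Derivatives are taken with respect to full neighbourhoods, so agreement on
  \<open>S\<close> passes to them because \<open>S\<close> is open.\<close>

lemma Ck_on_cong:
  assumes "open S" "\<And>x. x \<in> S \<Longrightarrow> f x = h x" "Ck_on k S f"
  shows "Ck_on k S h"
  using assms(2,3)
proof (induction k arbitrary: f h)
  case 0
  then show ?case using continuous_on_cong by fastforce
next
  case (Suc k)
  have "h differentiable (at x)" if "x \<in> S" for x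
  proof -
    have "(f has_derivative frechet_derivative f (at x)) (at x)"
      using Suc.prems(2) that by (simp add: frechet_derivative_works)
    then show ?thesis
      using has_derivative_transform_within_open[OF _ assms(1) that, where g = h]
        Suc.prems(1)
      unfolding differentiable_def by blast
  qed
  moreover have "frechet_derivative f (at x) = frechet_derivative h (at x)" if "x \<in> S" for x
    using frechet_derivative_transform_within_open[OF _ assms(1) that Suc.prems(1)] Suc.prems(2) that
    by simp
  then have "Ck_on k S (\<lambda>x. frechet_derivative h (at x) v)" for v
    using Suc.prems(2) by (rule_tac Suc.IH[of "\<lambda>x. frechet_derivative f (at x) v"]) auto
  ultimately show ?case by simp
qed

lemma Ck_on_Un:
  assumes "open S" "open T" "Ck_on k S f" "Ck_on k T f"
  shows "Ck_on k (S \<union> T) f"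
  using assms(3,4)
proof (induction k arbitrary: f)
  case 0
  then show ?case using continuous_on_open_Un[OF assms(1,2)] by simp
next
  case (Suc k)
  then show ?case by (simp add: Ball_def)
qed

lemma Ck_on_const: "Ck_on k S (\<lambda>x. c)"
  by (induction k arbitrary: c) (auto simp: frechet_derivative_const)

text \<open>\<open>frechet_derivative\<close> is a choice operator. Uniqueness of derivatives lets
  any explicit \<open>f'\<close> replace it; the closure proofs below supply one from the
  differentiation rules.\<close>

lemma Ck_on_SucI:
  assumes "open S"
    and "\<And>x. x \<in> S \<Longrightarrow> (f has_derivative f' x) (at x)"
    and "\<And>v. Ck_on k S (\<lambda>x. f' x v)"
  shows "Ck_on (Suc k) S f"
proof -
  have "frechet_derivative f (at x) = f' x" if "x \<in> S" for x
    using frechet_derivative_at[OF assms(2)[OF that]] by simp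
  then have "Ck_on k S (\<lambda>x. frechet_derivative f (at x) v)" for v
    using Ck_on_cong[OF assms(1) _ assms(3)[of v]] by simp
  then show ?thesis using assms(2) by (auto simp: differentiable_def)
qed

lemma Ck_on_Suc_has_derivative:
  "Ck_on (Suc k) S f \<Longrightarrow> x \<in> S \<Longrightarrow> (f has_derivative frechet_derivative f (at x)) (at x)"
  by (simp add: frechet_derivative_works)

lemma Ck_on_bounded_linear:
  assumes "open S" "bounded_linear L" "Ck_on k S f"
  shows "Ck_on k S (\<lambda>x. L (f x))"
  using assms(3)
proof (induction k arbitrary: f)
  case 0
  then show ?case using assms(2) by (simp add: bounded_linear.continuous_on)
next
  case (Suc k)
  have "Ck_on k S (\<lambda>x. L (frechet_derivative f (at x) v))" for v
    using Suc.prems by (intro Suc.IH) simp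
  with assms(1) bounded_linear.has_derivative[OF assms(2) Ck_on_Suc_has_derivative[OF Suc.prems]]
  show ?case by (rule Ck_on_SucI)
qed

lemma Ck_on_add:
  assumes "open S" "Ck_on k S f" "Ck_on k S h"
  shows "Ck_on k S (\<lambda>x. f x + h x)"
  using assms(2,3)
proof (induction k arbitrary: f h)
  case 0
  then show ?case by (simp add: continuous_on_add)
next
  case (Suc k)
  have "Ck_on k S (\<lambda>x. frechet_derivative f (at x) v + frechet_derivative h (at x) v)" for v
    using Suc.prems by (intro Suc.IH) simp_all
  with assms(1) has_derivative_add[OF Ck_on_Suc_has_derivative[OF Suc.prems(1)]
      Ck_on_Suc_has_derivative[OF Suc.prems(2)]]
  show ?case by (rule Ck_on_SucI)
qed

lemma Ck_on_mult:
  fixes f h :: "'a::euclidean_space \<Rightarrow> real"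
  assumes "open S" "Ck_on k S f" "Ck_on k S h"
  shows "Ck_on k S (\<lambda>x. f x * h x)"
  using assms(2,3)
proof (induction k arbitrary: f h)
  case 0
  then show ?case by (simp add: continuous_on_mult)
next
  case (Suc k)
  have "Ck_on k S (\<lambda>x. f x * frechet_derivative h (at x) v + frechet_derivative f (at x) v * h x)" for v
    using Suc.prems by (intro Ck_on_add[OF assms(1)] Suc.IH Ck_on_Suc_imp_Ck_on[OF Suc.prems(1)]
        Ck_on_Suc_imp_Ck_on[OF Suc.prems(2)]) simp_all
  with assms(1) has_derivative_mult[OF Ck_on_Suc_has_derivative[OF Suc.prems(1)]
      Ck_on_Suc_has_derivative[OF Suc.prems(2)]]
  show ?case by (rule Ck_on_SucI)
qed

lemma Ck_on_sum:
  assumes "open S" "\<And>i. i \<in> I \<Longrightarrow> Ck_on k S (f i)"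
  shows "Ck_on k S (\<lambda>x. \<Sum>i\<in>I. f i x)"
  using assms(2)
  by (induction I rule: infinite_finite_induct) (auto intro: Ck_on_const Ck_on_add[OF assms(1)])

text \<open>The chain rule evaluates \<open>f'\<close> in the direction \<open>h' x v\<close>, which
  moves with \<open>x\<close>, while \<open>Ck_on\<close> differentiates in fixed directions.
  Expanding in \<open>Basis\<close> leaves fixed directions \<open>b\<close> with scalar
  coefficients, and the induction hypothesis applies to each \<open>f' (h x) b\<close>.\<close>

lemma Ck_on_compose:
  fixes f :: "'b::euclidean_space \<Rightarrow> real" and h :: "'a::euclidean_space \<Rightarrow> 'b"
  assumes "open S" "open T" "h ` S \<subseteq> T" "Ck_on k S h" "Ck_on k T f"
  shows "Ck_on k S (\<lambda>x. f (h x))"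
  using assms(4,5)
proof (induction k arbitrary: f)
  case 0
  then show ?case using assms(3) by (auto intro: continuous_on_compose2)
next
  case (Suc k)
  define f' where "f' = (\<lambda>x. frechet_derivative f (at x))"
  define h' where "h' = (\<lambda>x. frechet_derivative h (at x))"
  define d where "d = (\<lambda>x v. \<Sum>b\<in>Basis. (h' x v \<bullet> b) * f' (h x) b)"
  have der: "((\<lambda>x. f (h x)) has_derivative d x) (at x)" if "x \<in> S" for x
  proof -
    have F: "(f has_derivative f' (h x)) (at (h x))"
      unfolding f'_def using that assms(3) by (intro Ck_on_Suc_has_derivative[OF Suc.prems(2)]) auto
    have rep: "f' (h x) w = (\<Sum>b\<in>Basis. (w \<bullet> b) * f' (h x) b)" for w
    proof -
      have "linear (f' (h x))" using F by (rule has_derivative_linear)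
      then have "f' (h x) (\<Sum>b\<in>Basis. (w \<bullet> b) *\<^sub>R b) = (\<Sum>b\<in>Basis. (w \<bullet> b) * f' (h x) b)"
        by (simp add: linear_sum linear_scale)
      then show ?thesis by (simp add: euclidean_representation)
    qed
    have "d x = (\<lambda>v. f' (h x) (h' x v))"
      unfolding d_def by (rule ext) (rule rep[symmetric])
    then show ?thesis
      using has_derivative_compose[OF Ck_on_Suc_has_derivative[OF Suc.prems(1) that] F]
      by (simp add: h'_def)
  qed
  have "Ck_on k S (\<lambda>x. d x v)" for v
    unfolding d_def
  proof (intro Ck_on_sum Ck_on_mult assms(1))
    fix b :: 'b assume "b \<in> Basis"
    show "Ck_on k S (\<lambda>x. h' x v \<bullet> b)"
      using Suc.prems by (intro Ck_on_bounded_linear[OF assms(1) bounded_linear_inner_left])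
        (simp add: h'_def)
    show "Ck_on k S (\<lambda>x. f' (h x) b)"
      using Suc.prems(2) by (intro Suc.IH Ck_on_Suc_imp_Ck_on[OF Suc.prems(1)]) (simp add: f'_def)
  qed
  with assms(1) der show ?case by (rule Ck_on_SucI)
qed

lemma Ck_on_id: "Ck_on k S (\<lambda>x. x)"
proof (cases k)
  case (Suc j)
  have "(\<lambda>x. frechet_derivative (\<lambda>x. x) (at x) v) = (\<lambda>x. v)" for v :: 'a
    by (simp add: frechet_derivative_ident)
  then show ?thesis using Suc by (simp add: Ck_on_const)
qed simp

section \<open>Closure properties of C-infinity maps\<close>

lemma smooth_on_subset: "smooth_on S f \<Longrightarrow> T \<subseteq> S \<Longrightarrow> smooth_on T f"
  by (auto simp: smooth_on_def intro: Ck_on_subset)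

lemma smooth_on_cong:
  "open S \<Longrightarrow> (\<And>x. x \<in> S \<Longrightarrow> f x = h x) \<Longrightarrow> smooth_on S f \<Longrightarrow> smooth_on S h"
  unfolding smooth_on_def using Ck_on_cong by blast

lemma smooth_on_Un:
  "open S \<Longrightarrow> open T \<Longrightarrow> smooth_on S f \<Longrightarrow> smooth_on T f \<Longrightarrow> smooth_on (S \<union> T) f"
  by (simp add: smooth_on_def Ck_on_Un)

lemma smooth_on_const: "smooth_on S (\<lambda>x. c)"
  by (simp add: smooth_on_def Ck_on_const)

lemma smooth_on_id: "smooth_on S (\<lambda>x. x)"
  by (simp add: smooth_on_def Ck_on_id)

lemma smooth_on_bounded_linear:
  "open S \<Longrightarrow> bounded_linear L \<Longrightarrow> smooth_on S f \<Longrightarrow> smooth_on S (\<lambda>x. L (f x))"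
  by (simp add: smooth_on_def Ck_on_bounded_linear)

lemma smooth_on_add:
  "open S \<Longrightarrow> smooth_on S f \<Longrightarrow> smooth_on S h \<Longrightarrow> smooth_on S (\<lambda>x. f x + h x)"
  by (simp add: smooth_on_def Ck_on_add)

lemma smooth_on_mult:
  fixes f h :: "'a::euclidean_space \<Rightarrow> real"
  shows "open S \<Longrightarrow> smooth_on S f \<Longrightarrow> smooth_on S h \<Longrightarrow> smooth_on S (\<lambda>x. f x * h x)"
  by (simp add: smooth_on_def Ck_on_mult)

lemma smooth_on_sum:
  "open S \<Longrightarrow> (\<And>i. i \<in> I \<Longrightarrow> smooth_on S (f i)) \<Longrightarrow> smooth_on S (\<lambda>x. \<Sum>i\<in>I. f i x)"
  by (simp add: smooth_on_def Ck_on_sum)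

lemma smooth_on_diff:
  assumes "open S" "smooth_on S f" "smooth_on S h"
  shows "smooth_on S (\<lambda>x. f x - h x)"
  using smooth_on_add[OF assms(1,2) smooth_on_bounded_linear[OF assms(1) bounded_linear_minus[OF bounded_linear_ident] assms(3)]]
  by simp

lemma smooth_on_compose:
  fixes f :: "'b::euclidean_space \<Rightarrow> real"
  shows "open S \<Longrightarrow> open T \<Longrightarrow> h ` S \<subseteq> T \<Longrightarrow> smooth_on S h \<Longrightarrow> smooth_on T f \<Longrightarrow>
    smooth_on S (\<lambda>x. f (h x))"
  using Ck_on_compose unfolding smooth_on_def by blast

lemma smooth_on_has_derivative:
  "smooth_on S f \<Longrightarrow> x \<in> S \<Longrightarrow> (f has_derivative frechet_derivative f (at x)) (at x)"
  unfolding smooth_on_def using Ck_on_Suc_has_derivative by blast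

lemma smooth_on_frechet_derivative:
  "smooth_on S f \<Longrightarrow> smooth_on S (\<lambda>x. frechet_derivative f (at x) v)"
  unfolding smooth_on_def
proof
  fix k
  assume "\<forall>k. Ck_on k S f"
  then have "Ck_on (Suc k) S f" ..
  then show "Ck_on k S (\<lambda>x. frechet_derivative f (at x) v)" by simp
qed

lemma smooth_on_imp_continuous_on: "smooth_on S f \<Longrightarrow> continuous_on S f"
  unfolding smooth_on_def using Ck_on.simps(1) by blast

section \<open>Cutoff functions built from exp (- 1 / t)\<close>

text \<open>The span of the functions \<open>flat m\<close> is closed under differentiation, so all of them are smooth at once.\<close>

definition flat :: "nat \<Rightarrow> real \<Rightarrow> real" where
  "flat m t = (if t > 0 then (1 / t) ^ m * exp (- (1 / t)) else 0)"

text \<open>With s = 1 / t this is the decay of s ^ m / exp s at infinity.\<close>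

lemma tendsto_flat_at_right_0: "(flat m \<longlongrightarrow> 0) (at_right 0)"
proof -
  have "((\<lambda>t. inverse t ^ m / exp (inverse t)) \<longlongrightarrow> (0::real)) (at_right 0)"
    using filterlim_compose[OF tendsto_power_div_exp_0 filterlim_inverse_at_top_right] .
  then show ?thesis
  proof (rule Lim_transform_eventually)
    show "\<forall>\<^sub>F t in at_right 0. inverse t ^ m / exp (inverse t) = flat m t"
      by (auto simp: eventually_at_filter flat_def exp_minus divide_inverse)
  qed
qed

lemma has_real_derivative_flat:
  "(flat m has_real_derivative (flat (m + 2) t - real m * flat (m + 1) t)) (at t)"
proof -
  consider "t > 0" | "t < 0" | "t = 0" by linarith
  then show ?thesis
  proof cases
    case 1
    have "((\<lambda>t. (1 / t) ^ m * exp (- (1 / t))) has_real_derivative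
        (flat (m + 2) t - real m * flat (m + 1) t)) (at t)"
      using 1 by (auto intro!: derivative_eq_intros simp: flat_def) (cases m; simp add: field_simps power2_eq_square)
    then show ?thesis
      by (rule has_field_derivative_transform_within_open[of _ _ _ "{0<..}"]) (use 1 in \<open>auto simp: flat_def\<close>)
  next
    case 2
    then have *: "flat (m + 2) t - real m * flat (m + 1) t = 0" by (simp add: flat_def)
    show ?thesis
      unfolding * by (rule has_field_derivative_transform_within_open[of "\<lambda>_. 0" _ _ "{..<0}"])
        (use 2 in \<open>auto simp: flat_def\<close>)
  next
    case 3
    \<comment> \<open>To the right of 0 the difference quotient of \<open>flat m\<close> is
      \<open>flat (Suc m)\<close>; to the left it is 0.\<close>
    have r: "((\<lambda>y. (flat m y - flat m 0) / (y - 0)) \<longlongrightarrow> 0) (at_right 0)"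
      by (rule Lim_transform_eventually[OF tendsto_flat_at_right_0[of "Suc m"]])
        (auto simp: eventually_at_filter flat_def)
    have l: "((\<lambda>y. (flat m y - flat m 0) / (y - 0)) \<longlongrightarrow> 0) (at_left 0)"
      by (rule Lim_transform_eventually[OF tendsto_const])
        (auto simp: eventually_at_filter flat_def)
    have "((\<lambda>y. (flat m y - flat m 0) / (y - 0)) \<longlongrightarrow> 0) (at 0)"
      using l r filterlim_split_at by blast
    then show ?thesis using 3 by (simp add: has_field_derivative_iff flat_def)
  qed
qed

lemma smooth_on_flat: "smooth_on S (flat m)"
proof -
  have "Ck_on k UNIV (flat m)" for k
  proof (induction k arbitrary: m)
    case 0
    show ?case using has_real_derivative_flat
      by (auto intro!: continuous_at_imp_continuous_on DERIV_isCont)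
  next
    case (Suc k)
    have "Ck_on k UNIV (\<lambda>t. (flat (m + 2) t + (- real m) * flat (m + 1) t) * v)" for v
      by (intro Ck_on_mult Ck_on_add Ck_on_const Suc.IH) auto
    then show ?case
      by (intro Ck_on_SucI[OF _ has_field_derivative_imp_has_derivative[OF has_real_derivative_flat]]) auto
  qed
  then show ?thesis using smooth_on_subset smooth_on_def by blast
qed

text \<open>The squared distance is a polynomial in the coordinates, hence smooth also at the
  centre, where the norm is not.\<close>

definition bump :: "'a::euclidean_space \<Rightarrow> real \<Rightarrow> 'a \<Rightarrow> real" where
  "bump c r x = flat 0 (r\<^sup>2 - (x - c) \<bullet> (x - c))"

lemma smooth_on_bump:
  assumes "open S" shows "smooth_on S (bump c r)"
proof -
  have "smooth_on S (\<lambda>x. x - c)"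
    using assms by (intro smooth_on_diff smooth_on_id smooth_on_const)
  then have "smooth_on S (\<lambda>x. ((x - c) \<bullet> b) * ((x - c) \<bullet> b))" for b
    using assms by (intro smooth_on_mult smooth_on_bounded_linear[OF _ bounded_linear_inner_left]) auto
  then have "smooth_on S (\<lambda>x. \<Sum>b\<in>Basis. ((x - c) \<bullet> b) * ((x - c) \<bullet> b))"
    using assms by (intro smooth_on_sum)
  then have "smooth_on S (\<lambda>x. r\<^sup>2 - (x - c) \<bullet> (x - c))"
    using assms by (subst euclidean_inner) (intro smooth_on_diff smooth_on_const)
  then show ?thesis
    unfolding bump_def using assms by (intro smooth_on_compose[OF _ open_UNIV _ _ smooth_on_flat]) auto
qed

lemma bump_centre_pos: "r > 0 \<Longrightarrow> bump c r c > 0"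
  by (simp add: bump_def flat_def)

lemma bump_eq_0: "r > 0 \<Longrightarrow> x \<notin> cball c r \<Longrightarrow> bump c r x = 0"
proof -
  assume "r > 0" "x \<notin> cball c r"
  then have "r\<^sup>2 \<le> (norm (x - c))\<^sup>2"
    by (intro power_mono) (auto simp: dist_norm norm_minus_commute)
  then show ?thesis by (simp add: bump_def flat_def power2_norm_eq_inner)
qed

section \<open>Hadamard's lemma on a ball\<close>

text \<open>The weight \<open>t ^ m\<close> makes this family of integrals closed under differentiation.\<close>

lemma smooth_on_ray_integral:
  fixes H :: "'a::euclidean_space \<Rightarrow> real"
  assumes "smooth_on (ball c R) H"
  shows "smooth_on (ball c R) (\<lambda>x. integral {0..1} (\<lambda>t. t ^ m * H (c + t *\<^sub>R (x - c))))"
proof -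
  let ?S = "ball c R"
  have ray: "c + t *\<^sub>R (x - c) \<in> ?S" if "x \<in> ?S" "t \<in> {0..1}" for x t
  proof -
    have "t * norm (x - c) \<le> 1 * norm (x - c)" using that by (intro mult_right_mono) auto
    then show ?thesis using that by (auto simp: dist_norm norm_minus_commute)
  qed
  have cont: "continuous_on (?S \<times> {0..1}) (\<lambda>(x, t). t ^ m * H (c + t *\<^sub>R (x - c)))"
    if "smooth_on ?S H" for m and H :: "'a \<Rightarrow> real"
    unfolding split_beta
    by (intro continuous_intros continuous_on_compose2[OF smooth_on_imp_continuous_on[OF that]])
      (auto intro!: ray)
  have slice: "f x integrable_on {0..1}"
    if "continuous_on (?S \<times> {0..1}) (\<lambda>(x, t). f x t)" "x \<in> ?S"
    for x and f :: "'a \<Rightarrow> real \<Rightarrow> 'c::banach"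
  proof -
    have "continuous_on {0..1} (Pair x)" "Pair x ` {0..1} \<subseteq> ?S \<times> {0..1}"
      using that(2) by (auto intro!: continuous_intros)
    from continuous_on_compose2[OF that(1) this] show ?thesis
      by (simp add: integrable_continuous_real)
  qed
  have der: "((\<lambda>x. integral {0..1} (\<lambda>t. t ^ m * H (c + t *\<^sub>R (x - c)))) has_derivative
      (\<lambda>v. \<Sum>b\<in>Basis. (v \<bullet> b) *
         integral {0..1} (\<lambda>t. t ^ Suc m * frechet_derivative H (at (c + t *\<^sub>R (x - c))) b))) (at x)"
    if H: "smooth_on ?S H" and x: "x \<in> ?S" for m x and H :: "'a \<Rightarrow> real"
  proof -
    \<comment> \<open>Differentiating the ray in \<open>x\<close> contributes a factor t, which
      raises the weight to \<open>Suc m\<close>. The total derivative is assembled from coordinate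
      functionals because \<open>leibniz_rule\<close> asks for a bounded linear map that is
      continuous in (x, t); this reduces to continuity of the scalars \<open>d\<close>.\<close>
    define d where "d = (\<lambda>x t b. t ^ Suc m * frechet_derivative H (at (c + t *\<^sub>R (x - c))) b)"
    define fx where "fx = (\<lambda>x t. \<Sum>b\<in>Basis. d x t b *\<^sub>R blinfun_inner_left b)"
    have dcont: "continuous_on (?S \<times> {0..1}) (\<lambda>(x, t). d x t b)" for b
      unfolding d_def using cont[OF smooth_on_frechet_derivative[OF H, of b], of "Suc m"] .
    have fx: "((\<lambda>x. t ^ m * H (c + t *\<^sub>R (x - c))) has_derivative blinfun_apply (fx x t)) (at x within ?S)"
      if "x \<in> ?S" "t \<in> cbox 0 1" for x t
    proof -
      let ?H' = "frechet_derivative H (at (c + t *\<^sub>R (x - c)))"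
      have H': "(H has_derivative ?H') (at (c + t *\<^sub>R (x - c)))"
        using that by (intro smooth_on_has_derivative[OF H] ray) auto
      have lin: "linear ?H'" using H' by (rule has_derivative_linear)
      have rep: "?H' v = (\<Sum>b\<in>Basis. (v \<bullet> b) * ?H' b)" for v
      proof -
        have "?H' (\<Sum>b\<in>Basis. (v \<bullet> b) *\<^sub>R b) = (\<Sum>b\<in>Basis. (v \<bullet> b) * ?H' b)"
          using lin by (simp add: linear_sum linear_scale)
        then show ?thesis by (simp add: euclidean_representation)
      qed
      have "blinfun_apply (fx x t) v = t ^ m * ?H' (t *\<^sub>R v)" for v
        unfolding linear_scale[OF lin] rep[of v]
        by (simp add: fx_def d_def blinfun.sum_left blinfun.scaleR_left
            sum_distrib_left mult_ac inner_commute)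
      moreover have "((\<lambda>x. t ^ m * H (c + t *\<^sub>R (x - c))) has_derivative (\<lambda>v. t ^ m * ?H' (t *\<^sub>R v))) (at x within ?S)"
        by (intro has_derivative_mult_right has_derivative_compose[where f = "\<lambda>x. c + t *\<^sub>R (x - c)" and g = H, OF _ H'])
          (auto intro!: derivative_eq_intros)
      ultimately show ?thesis by presburger
    qed
    have int: "(\<lambda>t. t ^ m * H (c + t *\<^sub>R (x - c))) integrable_on cbox 0 1" if "x \<in> ?S" for x
      using slice[OF cont[OF H, of m] that] by simp
    have dint: "(\<lambda>t. d x t b) integrable_on {0..1}" for b
      using slice[OF dcont[of b] x] by simp
    have fxcont: "continuous_on (?S \<times> cbox 0 1) (\<lambda>(x, t). fx x t)"
      using dcont unfolding fx_def split_beta by (intro continuous_intros) auto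
    have fxint: "fx x integrable_on {0..1}"
      using slice[of fx] fxcont x by simp
    have "((\<lambda>x. integral (cbox 0 1) (\<lambda>t. t ^ m * H (c + t *\<^sub>R (x - c)))) has_derivative
        blinfun_apply (integral (cbox 0 1) (fx x))) (at x within ?S)"
      by (rule leibniz_rule[OF fx int fxcont x]) auto
    moreover have "blinfun_apply (integral (cbox 0 1) (fx x)) v
        = (\<Sum>b\<in>Basis. (v \<bullet> b) * integral {0..1} (\<lambda>t. d x t b))" for v
    proof -
      have "blinfun_apply (integral {0..1} (fx x)) v = integral {0..1} (\<lambda>t. blinfun_apply (fx x t) v)"
        using integral_linear[OF fxint blinfun.bounded_linear_left[of v]] by (simp add: o_def)
      also have "\<dots> = integral {0..1} (\<lambda>t. \<Sum>b\<in>Basis. d x t b * (v \<bullet> b))"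
        by (simp add: fx_def blinfun.sum_left blinfun.scaleR_left inner_commute)
      also have "\<dots> = (\<Sum>b\<in>Basis. integral {0..1} (\<lambda>t. d x t b * (v \<bullet> b)))"
        using dint by (intro integral_sum) (auto intro: integrable_on_mult_left)
      finally show ?thesis by (simp add: mult.commute)
    qed
    ultimately have "((\<lambda>x. integral {0..1} (\<lambda>t. t ^ m * H (c + t *\<^sub>R (x - c)))) has_derivative
        (\<lambda>v. \<Sum>b\<in>Basis. (v \<bullet> b) * integral {0..1} (\<lambda>t. d x t b))) (at x within ?S)"
      by (metis (no_types, lifting) box_real(2) ext)
    then show ?thesis using x by (simp add: d_def at_within_open[OF x])
  qed
  have "Ck_on k ?S (\<lambda>x. integral {0..1} (\<lambda>t. t ^ m * H (c + t *\<^sub>R (x - c))))"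
    if "smooth_on ?S H" for k m and H :: "'a \<Rightarrow> real"
    using that
  proof (induction k arbitrary: m H)
    case 0
    then show ?case using der[OF 0]
      by (auto intro!: continuous_at_imp_continuous_on has_derivative_continuous)
  next
    case (Suc k)
    have "Ck_on k ?S (\<lambda>x. \<Sum>b\<in>Basis. (v \<bullet> b) * integral {0..1}
        (\<lambda>t. t ^ Suc m * frechet_derivative H (at (c + t *\<^sub>R (x - c))) b))" for v
      by (intro Ck_on_sum Ck_on_mult Ck_on_const Suc.IH smooth_on_frechet_derivative Suc.prems
          open_ball)
    with open_ball der[OF Suc.prems] show ?case by (rule Ck_on_SucI)
  qed
  then show ?thesis using assms by (simp add: smooth_on_def)
qed

text \<open>Fundamental theorem of calculus on the segment from \<open>c\<close> to
  \<open>x\<close>, which stays in the ball. Expanding the direction x - c in \<open>Basis\<close>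
  leaves the averages of the partial derivatives along the segment as the functions
  \<open>G b\<close>.\<close>

lemma hadamard:
  fixes F :: "'a::euclidean_space \<Rightarrow> real"
  assumes F: "smooth_on (ball c R) F"
  obtains G where "\<And>b. smooth_on (ball c R) (G b)"
    "\<And>b. G b c = frechet_derivative F (at c) b"
    "\<And>x. x \<in> ball c R \<Longrightarrow> F x = F c + (\<Sum>b\<in>Basis. ((x - c) \<bullet> b) * G b x)"
proof
  \<comment> \<open>The factor \<open>t ^ 0\<close> puts the integral in the form of
    \<open>smooth_on_ray_integral\<close>.\<close>
  define G where "G = (\<lambda>b x. integral {0..1} (\<lambda>t::real. t ^ 0 * frechet_derivative F (at (c + t *\<^sub>R (x - c))) b))"
  show "smooth_on (ball c R) (G b)" for b
    unfolding G_def by (rule smooth_on_ray_integral[OF smooth_on_frechet_derivative[OF F]])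
  show "G b c = frechet_derivative F (at c) b" for b
    by (simp add: G_def)
  show "F x = F c + (\<Sum>b\<in>Basis. ((x - c) \<bullet> b) * G b x)" if x: "x \<in> ball c R" for x
  proof -
    let ?F' = "\<lambda>t. frechet_derivative F (at (c + t *\<^sub>R (x - c)))"
    have ray: "c + t *\<^sub>R (x - c) \<in> ball c R" if "t \<in> {0..1}" for t
    proof -
      have "t * norm (x - c) \<le> 1 * norm (x - c)" using that by (intro mult_right_mono) auto
      then show ?thesis using that x by (auto simp: dist_norm norm_minus_commute)
    qed
    have F': "(F has_derivative ?F' t) (at (c + t *\<^sub>R (x - c)))" if "t \<in> {0..1}" for t
      using smooth_on_has_derivative[OF F ray[OF that]] .
    have sum: "?F' t (x - c) = (\<Sum>b\<in>Basis. ((x - c) \<bullet> b) * ?F' t b)" if "t \<in> {0..1}" for t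
    proof -
      have "?F' t (\<Sum>b\<in>Basis. ((x - c) \<bullet> b) *\<^sub>R b) = (\<Sum>b\<in>Basis. ((x - c) \<bullet> b) * ?F' t b)"
        using has_derivative_linear[OF F'[OF that]] by (simp add: linear_sum linear_scale)
      then show ?thesis by (simp add: euclidean_representation)
    qed
    have "((\<lambda>t. F (c + t *\<^sub>R (x - c))) has_vector_derivative ?F' t (x - c)) (at t within {0..1})"
      if "t \<in> {0..1}" for t
    proof -
      have "((\<lambda>t. F (c + t *\<^sub>R (x - c))) has_derivative (\<lambda>s. ?F' t (s *\<^sub>R (x - c)))) (at t within {0..1})"
        by (rule has_derivative_compose[where f = "\<lambda>t. c + t *\<^sub>R (x - c)" and g = F, OF _ F'[OF that]]) (auto intro!: derivative_eq_intros)
      then show ?thesis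
        using has_derivative_linear[OF F'[OF that]] by (simp add: has_vector_derivative_def linear_scale)
    qed
    from fundamental_theorem_of_calculus[OF _ this]
    have "((\<lambda>t. ?F' t (x - c)) has_integral (F x - F c)) {0..1}" by simp
    then have "F x - F c = integral {0..1} (\<lambda>t. ?F' t (x - c))"
      by (simp add: integral_unique)
    also have "\<dots> = integral {0..1} (\<lambda>t. \<Sum>b\<in>Basis. ((x - c) \<bullet> b) * ?F' t b)"
      by (rule integral_cong) (rule sum)
    also have "\<dots> = (\<Sum>b\<in>Basis. integral {0..1} (\<lambda>t. ((x - c) \<bullet> b) * ?F' t b))"
    proof (rule integral_sum)
      fix b :: 'a
      have "continuous_on {0..1} (\<lambda>t. ?F' t b)"
        using ray by (intro continuous_on_compose2[OF
              smooth_on_imp_continuous_on[OF smooth_on_frechet_derivative[OF F]]])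
          (auto intro!: continuous_intros simp del: mem_ball)
      then show "(\<lambda>t. ((x - c) \<bullet> b) * ?F' t b) integrable_on {0..1}"
        by (intro integrable_continuous_real continuous_intros)
    qed simp
    finally show ?thesis by (simp add: G_def)
  qed
qed

section \<open>Tangent spaces of a smooth manifold\<close>

text \<open>The tangent vector at \<open>q\<close> with components \<open>w\<close> in the chart.
  The value 0 off the smooth functions is the one that \<open>tangent_space\<close>
  prescribes.\<close>

definition chart_derivative ::
  "('m, 'e::euclidean_space) chart set \<Rightarrow> 'm set \<Rightarrow> ('m \<Rightarrow> 'e) \<Rightarrow> 'm \<Rightarrow> 'e \<Rightarrow> 'm tangent_vector" where
  "chart_derivative A U \<psi> q w f =
     (if f \<in> smooth_functions A then frechet_derivative (f \<circ> inv_into U \<psi>) (at (\<psi> q)) w else 0)"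

locale smooth_manifold =
  fixes A :: "('m::t2_space, 'e::euclidean_space) chart set"
  assumes atlas: "smooth_atlas A"
begin

lemma chart_homeomorphism: "(U, \<psi>) \<in> A \<Longrightarrow> homeomorphism U (\<psi> ` U) \<psi> (inv_into U \<psi>)"
  and open_chart_domain: "(U, \<psi>) \<in> A \<Longrightarrow> open U"
  and open_chart_image: "(U, \<psi>) \<in> A \<Longrightarrow> open (\<psi> ` U)"
  and smooth_transition: "(U, \<psi>) \<in> A \<Longrightarrow> (V, \<theta>) \<in> A \<Longrightarrow>
    smooth_on (\<psi> ` (U \<inter> V)) (\<theta> \<circ> inv_into U \<psi>)"
  using atlas unfolding smooth_atlas_def by blast+

lemma chart_at: obtains U \<psi> where "(U, \<psi>) \<in> A" "p \<in> U"
proof -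
  have "p \<in> (\<Union>(U, \<psi>)\<in>A. U)" using atlas by (simp add: smooth_atlas_def)
  then show ?thesis using that by blast
qed

lemma chart_inverse: "(U, \<psi>) \<in> A \<Longrightarrow> q \<in> U \<Longrightarrow> inv_into U \<psi> (\<psi> q) = q"
  using chart_homeomorphism by (meson homeomorphism_apply1)

lemma open_chart_image_subset:
  assumes "(U, \<psi>) \<in> A" "open W" "W \<subseteq> U" shows "open (\<psi> ` W)"
proof -
  have "openin (top_of_set (\<psi> ` U)) (\<psi> ` W)"
    using assms by (intro homeomorphism_imp_open_map[OF chart_homeomorphism[OF assms(1)]])
      (auto simp: openin_open)
  then show ?thesis using open_chart_image[OF assms(1)] openin_open_trans by blast
qed

lemma smooth_functionsD:
  "f \<in> smooth_functions A \<Longrightarrow> (U, \<psi>) \<in> A \<Longrightarrow> smooth_on (\<psi> ` U) (\<lambda>x. f (inv_into U \<psi> x))"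
  by (auto simp: smooth_functions_def o_def)

lemma smooth_functions_const: "(\<lambda>q. c) \<in> smooth_functions A"
  by (auto simp: smooth_functions_def o_def smooth_on_const)

lemma smooth_functions_add:
  "f \<in> smooth_functions A \<Longrightarrow> h \<in> smooth_functions A \<Longrightarrow> (\<lambda>q. f q + h q) \<in> smooth_functions A"
  by (auto simp: smooth_functions_def o_def open_chart_image intro!: smooth_on_add)

lemma smooth_functions_mult:
  "f \<in> smooth_functions A \<Longrightarrow> h \<in> smooth_functions A \<Longrightarrow> (\<lambda>q. f q * h q) \<in> smooth_functions A"
  by (auto simp: smooth_functions_def o_def open_chart_image intro!: smooth_on_mult)

lemma smooth_functions_diff:
  "f \<in> smooth_functions A \<Longrightarrow> h \<in> smooth_functions A \<Longrightarrow> (\<lambda>q. f q - h q) \<in> smooth_functions A"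
  by (auto simp: smooth_functions_def o_def open_chart_image intro!: smooth_on_diff)

lemma smooth_functions_scale:
  "f \<in> smooth_functions A \<Longrightarrow> (\<lambda>q. r * f q) \<in> smooth_functions A"
  by (rule smooth_functions_mult[OF smooth_functions_const])

text \<open>Two open sets cover the manifold: the part of \<open>U\<close> lying over
  \<open>S\<close>, where the function is a chart expression, and the complement of the preimage
  \<open>K\<close> of \<open>C\<close>, where it is 0. \<open>K\<close> is closed because it is
  compact in a Hausdorff space.\<close>

lemma smooth_functions_extend_by_0:
  assumes U: "(U, \<psi>) \<in> A" and S: "open S" "S \<subseteq> \<psi> ` U" and C: "compact C" "C \<subseteq> S"
    and H: "smooth_on S H" "\<And>x. x \<in> S \<Longrightarrow> x \<notin> C \<Longrightarrow> H x = 0"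
  shows "(\<lambda>q. if q \<in> U \<and> \<psi> q \<in> S then H (\<psi> q) else 0) \<in> smooth_functions A"
proof -
  define F where "F = (\<lambda>q. if q \<in> U \<and> \<psi> q \<in> S then H (\<psi> q) else 0)"
  define K where "K = inv_into U \<psi> ` C"
  define W where "W = U \<inter> \<psi> -` S"
  have "continuous_on C (inv_into U \<psi>)"
    using chart_homeomorphism[OF U] S C by (meson continuous_on_subset homeomorphism_def order_trans)
  then have "closed K"
    unfolding K_def by (intro compact_imp_closed compact_continuous_image C)
  have "open W"
    unfolding W_def using chart_homeomorphism[OF U]
    by (intro continuous_open_preimage open_chart_domain[OF U] S) (simp add: homeomorphism_def)
  have "K \<subseteq> W"
  proof
    fix q assume "q \<in> K"
    then obtain x where x: "x \<in> C" "q = inv_into U \<psi> x" by (auto simp: K_def)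
    then obtain q' where "q' \<in> U" "x = \<psi> q'" using S C by blast
    then show "q \<in> W" using x C chart_inverse[OF U] by (auto simp: W_def)
  qed
  have F0: "F q = 0" if "q \<notin> K" for q
  proof (cases "q \<in> U \<and> \<psi> q \<in> S")
    case True
    then have "\<psi> q \<notin> C"
      using that chart_inverse[OF U] unfolding K_def by (metis image_eqI)
    then show ?thesis using True H(2) by (simp add: F_def)
  qed (auto simp: F_def)
  have "smooth_on (\<theta> ` V) (F \<circ> inv_into V \<theta>)" if V: "(V, \<theta>) \<in> A" for V \<theta>
  proof -
    have o1: "open (\<theta> ` (V \<inter> W))" and o2: "open (\<theta> ` (V - K))"
      using \<open>open W\<close> \<open>closed K\<close> open_chart_domain[OF V]
      by (auto intro!: open_chart_image_subset[OF V])
    have "smooth_on (\<theta> ` (V \<inter> W)) (\<lambda>x. H ((\<psi> \<circ> inv_into V \<theta>) x))"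
    proof (rule smooth_on_compose[OF o1 S(1) _ _ H(1)])
      show "(\<psi> \<circ> inv_into V \<theta>) ` \<theta> ` (V \<inter> W) \<subseteq> S"
        using chart_inverse[OF V] by (auto simp: W_def)
      show "smooth_on (\<theta> ` (V \<inter> W)) (\<psi> \<circ> inv_into V \<theta>)"
        by (rule smooth_on_subset[OF smooth_transition[OF V U]]) (auto simp: W_def)
    qed
    then have s1: "smooth_on (\<theta> ` (V \<inter> W)) (F \<circ> inv_into V \<theta>)"
      by (rule smooth_on_cong[OF o1, rotated]) (auto simp: W_def F_def chart_inverse[OF V])
    have s2: "smooth_on (\<theta> ` (V - K)) (F \<circ> inv_into V \<theta>)"
      by (rule smooth_on_cong[OF o2 _ smooth_on_const[of _ 0]]) (auto simp: F0 chart_inverse[OF V])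
    have "\<theta> ` V = \<theta> ` (V \<inter> W) \<union> \<theta> ` (V - K)" using \<open>K \<subseteq> W\<close> by blast
    then show ?thesis using smooth_on_Un[OF o1 o2 s1 s2] by simp
  qed
  then show ?thesis by (auto simp: smooth_functions_def F_def)
qed

lemma tangent_spaceI:
  assumes "\<And>f h. f \<in> smooth_functions A \<Longrightarrow> h \<in> smooth_functions A \<Longrightarrow>
      v (\<lambda>q. f q + h q) = v f + v h"
    and "\<And>r f. f \<in> smooth_functions A \<Longrightarrow> v (\<lambda>q. r * f q) = r * v f"
    and "\<And>f h. f \<in> smooth_functions A \<Longrightarrow> h \<in> smooth_functions A \<Longrightarrow>
      v (\<lambda>q. f q * h q) = f p * v h + h p * v f"
    and "\<And>f. f \<notin> smooth_functions A \<Longrightarrow> v f = 0"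
  shows "v \<in> tangent_space A p"
  using assms by (simp add: tangent_space_def linear_map_on_def plus_fun_def times_fun_def scaleR_fun_def)

lemma tangent_spaceD:
  assumes "v \<in> tangent_space A p"
  shows "f \<in> smooth_functions A \<Longrightarrow> h \<in> smooth_functions A \<Longrightarrow> v (\<lambda>q. f q + h q) = v f + v h"
    and "f \<in> smooth_functions A \<Longrightarrow> v (\<lambda>q. r * f q) = r * v f"
    and "f \<in> smooth_functions A \<Longrightarrow> h \<in> smooth_functions A \<Longrightarrow>
      v (\<lambda>q. f q * h q) = f p * v h + h p * v f"
    and "f \<notin> smooth_functions A \<Longrightarrow> v f = 0"
  using assms by (simp_all add: tangent_space_def linear_map_on_def plus_fun_def times_fun_def scaleR_fun_def)

text \<open>Smoothness of the partial sums is proved alongside, because \<open>v\<close> is additive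
  only on smooth functions.\<close>

lemma tangent_vector_sum:
  assumes v: "v \<in> tangent_space A p" and f: "\<And>i. i \<in> I \<Longrightarrow> f i \<in> smooth_functions A"
  shows "(\<lambda>q. \<Sum>i\<in>I. f i q) \<in> smooth_functions A \<and> v (\<lambda>q. \<Sum>i\<in>I. f i q) = (\<Sum>i\<in>I. v (f i))"
  using f
proof (induction I rule: infinite_finite_induct)
  case (insert i I)
  then show ?case using tangent_spaceD(1)[OF v] smooth_functions_add by simp
qed (use tangent_spaceD(2)[OF v smooth_functions_const, of 0 0] smooth_functions_const in auto)

lemma subspace_tangent_space: "subspace (tangent_space A p)"
proof (rule subspaceI)
  show "0 \<in> tangent_space A p" by (rule tangent_spaceI) auto
  show "v + w \<in> tangent_space A p" if "v \<in> tangent_space A p" "w \<in> tangent_space A p" for v w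
    using that by (intro tangent_spaceI) (simp_all add: tangent_spaceD algebra_simps)
  show "r *\<^sub>R v \<in> tangent_space A p" if "v \<in> tangent_space A p" for r v
    using that by (intro tangent_spaceI) (simp_all add: tangent_spaceD scaleR_fun_def algebra_simps)
qed

lemma chart_has_derivative:
  assumes "(U, \<psi>) \<in> A" "q \<in> U" "f \<in> smooth_functions A"
  shows "((\<lambda>x. f (inv_into U \<psi> x)) has_derivative (\<lambda>w. chart_derivative A U \<psi> q w f)) (at (\<psi> q))"
  using smooth_on_has_derivative[OF smooth_functionsD[OF assms(3,1)], of "\<psi> q"] assms
  by (simp add: chart_derivative_def o_def)

lemma chart_derivative_eqI:
  assumes "(U, \<psi>) \<in> A" "q \<in> U" "f \<in> smooth_functions A"
    and "((\<lambda>x. f (inv_into U \<psi> x)) has_derivative f') (at (\<psi> q))"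
  shows "chart_derivative A U \<psi> q w f = f' w"
  using has_derivative_unique[OF chart_has_derivative[OF assms(1-3)] assms(4)] by meson

lemma chart_derivative_tangent:
  assumes U: "(U, \<psi>) \<in> A" and q: "q \<in> U"
  shows "chart_derivative A U \<psi> q w \<in> tangent_space A q"
proof (rule tangent_spaceI)
  fix f h :: "'m \<Rightarrow> real" and r :: real
  assume f: "f \<in> smooth_functions A"
  note df = chart_has_derivative[OF U q f]
  show "chart_derivative A U \<psi> q w (\<lambda>q. r * f q) = r * chart_derivative A U \<psi> q w f"
    by (rule chart_derivative_eqI[OF U q smooth_functions_scale[OF f] has_derivative_mult_right[OF df]])
  assume h: "h \<in> smooth_functions A"
  note dh = chart_has_derivative[OF U q h]
  show "chart_derivative A U \<psi> q w (\<lambda>q. f q + h q) =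
      chart_derivative A U \<psi> q w f + chart_derivative A U \<psi> q w h"
    by (rule chart_derivative_eqI[OF U q smooth_functions_add[OF f h] has_derivative_add[OF df dh]])
  show "chart_derivative A U \<psi> q w (\<lambda>q. f q * h q) =
      f q * chart_derivative A U \<psi> q w h + h q * chart_derivative A U \<psi> q w f"
    using chart_derivative_eqI[OF U q smooth_functions_mult[OF f h] has_derivative_mult[OF df dh]]
      chart_inverse[OF U q] by (simp add: mult.commute)
qed (simp add: chart_derivative_def)

lemma linear_chart_derivative:
  assumes U: "(U, \<psi>) \<in> A" and q: "q \<in> U"
  shows "linear (chart_derivative A U \<psi> q)"
proof
  fix w w' :: 'e and r :: real
  have lin: "linear (\<lambda>w. chart_derivative A U \<psi> q w f)" if "f \<in> smooth_functions A" for f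
    using has_derivative_linear[OF chart_has_derivative[OF U q that]] .
  show "chart_derivative A U \<psi> q (w + w') = chart_derivative A U \<psi> q w + chart_derivative A U \<psi> q w'"
  proof
    fix f show "chart_derivative A U \<psi> q (w + w') f =
        (chart_derivative A U \<psi> q w + chart_derivative A U \<psi> q w') f"
      using linear_add[OF lin, of f] by (cases "f \<in> smooth_functions A") (auto simp: chart_derivative_def)
  qed
  show "chart_derivative A U \<psi> q (r *\<^sub>R w) = r *\<^sub>R chart_derivative A U \<psi> q w"
  proof
    fix f show "chart_derivative A U \<psi> q (r *\<^sub>R w) f = (r *\<^sub>R chart_derivative A U \<psi> q w) f"
      using linear_scale[OF lin, of f]
      by (cases "f \<in> smooth_functions A") (auto simp: chart_derivative_def scaleR_fun_def)
  qed
qed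

end

section \<open>Localisation in a coordinate ball\<close>

locale chart_ball = smooth_manifold A
  for A :: "('m::t2_space, 'e::euclidean_space) chart set" +
  fixes U :: "'m set" and \<psi> :: "'m \<Rightarrow> 'e" and p :: 'm and R :: real
  assumes chart: "(U, \<psi>) \<in> A" and centre: "p \<in> U"
    and radius_pos: "R > 0" and ball_subset: "ball (\<psi> p) R \<subseteq> \<psi> ` U"
begin

text \<open>The radius \<open>R / 2\<close> keeps the support in a compact part of the ball, as
  \<open>smooth_functions_extend_by_0\<close> requires. The bump is not normalised; its value
  \<open>peak\<close> at \<open>p\<close> is divided out later.\<close>

definition cutoff :: "('e \<Rightarrow> real) \<Rightarrow> 'm \<Rightarrow> real" where
  "cutoff H q = (if q \<in> U \<and> \<psi> q \<in> ball (\<psi> p) R then bump (\<psi> p) (R / 2) (\<psi> q) * H (\<psi> q) else 0)"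

definition peak :: real where "peak = bump (\<psi> p) (R / 2) (\<psi> p)"

lemma peak_pos: "peak > 0"
  unfolding peak_def using radius_pos by (intro bump_centre_pos) simp

lemma cutoff_centre: "cutoff H p = peak * H (\<psi> p)"
  using centre radius_pos by (simp add: cutoff_def peak_def)

lemma cutoff_smooth:
  assumes "smooth_on (ball (\<psi> p) R) H"
  shows "cutoff H \<in> smooth_functions A"
proof -
  have "(\<lambda>q. if q \<in> U \<and> \<psi> q \<in> ball (\<psi> p) R then bump (\<psi> p) (R / 2) (\<psi> q) * H (\<psi> q) else 0)
      \<in> smooth_functions A"
  proof (rule smooth_functions_extend_by_0[OF chart open_ball ball_subset compact_cball])
    show "cball (\<psi> p) (R / 2) \<subseteq> ball (\<psi> p) R" using radius_pos by auto
    show "smooth_on (ball (\<psi> p) R) (\<lambda>x. bump (\<psi> p) (R / 2) x * H x)"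
      by (intro smooth_on_mult smooth_on_bump assms open_ball)
    show "bump (\<psi> p) (R / 2) x * H x = 0" if "x \<notin> cball (\<psi> p) (R / 2)" for x
      using bump_eq_0[OF _ that] radius_pos by simp
  qed
  then show ?thesis unfolding cutoff_def .
qed

definition coord :: "'e \<Rightarrow> 'm \<Rightarrow> real" where
  "coord b = cutoff (\<lambda>x. (x - \<psi> p) \<bullet> b)"

lemma coord_smooth: "coord b \<in> smooth_functions A"
  unfolding coord_def by (intro cutoff_smooth smooth_on_bounded_linear[OF _ bounded_linear_inner_left]
      smooth_on_diff smooth_on_id smooth_on_const open_ball)

text \<open>In the product rule the term with the derivative of the bump drops out, since the linear
  factor vanishes at the centre.\<close>

lemma chart_derivative_coord: "chart_derivative A U \<psi> p w (coord b) = peak * (w \<bullet> b)"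
proof -
  let ?B = "bump (\<psi> p) (R / 2)"
  have "(?B has_derivative frechet_derivative ?B (at (\<psi> p))) (at (\<psi> p))"
    by (rule smooth_on_has_derivative[OF smooth_on_bump[OF open_UNIV]]) simp
  moreover have "((\<lambda>x. (x - \<psi> p) \<bullet> b) has_derivative (\<lambda>w. w \<bullet> b)) (at (\<psi> p))"
    by (auto intro!: derivative_eq_intros)
  ultimately have "((\<lambda>x. ?B x * ((x - \<psi> p) \<bullet> b)) has_derivative (\<lambda>w. peak * (w \<bullet> b))) (at (\<psi> p))"
    using has_derivative_mult by (fastforce simp: peak_def)
  then have "((\<lambda>x. coord b (inv_into U \<psi> x)) has_derivative (\<lambda>w. peak * (w \<bullet> b))) (at (\<psi> p))"
  proof (rule has_derivative_transform_within_open[OF _ open_ball, of _ _ _ _ "\<psi> p" R])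
    show "\<psi> p \<in> ball (\<psi> p) R" using radius_pos by simp
    fix x assume x: "x \<in> ball (\<psi> p) R"
    then obtain q where "q \<in> U" "x = \<psi> q" using ball_subset by blast
    then show "?B x * ((x - \<psi> p) \<bullet> b) = coord b (inv_into U \<psi> x)"
      using x by (simp add: coord_def cutoff_def chart_inverse[OF chart])
  qed
  then show ?thesis by (rule chart_derivative_eqI[OF chart centre coord_smooth])
qed

text \<open>Multiplying by the square of a cutoff turns the Hadamard expansion in the chart into an
  identity between globally smooth functions, so that derivations need not be localised first.\<close>

lemma tangent_vector_eq_chart_derivative:
  assumes v: "v \<in> tangent_space A p"
  shows "v = chart_derivative A U \<psi> p (\<Sum>b\<in>Basis. (v (coord b) / peak) *\<^sub>R b)"
proof
  fix f
  show "v f = chart_derivative A U \<psi> p (\<Sum>b\<in>Basis. (v (coord b) / peak) *\<^sub>R b) f"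
  proof (cases "f \<in> smooth_functions A")
    case False
    then show ?thesis using tangent_spaceD(4)[OF v] by (simp add: chart_derivative_def)
  next
    case f: True
    let ?F = "\<lambda>x. f (inv_into U \<psi> x)"
    obtain G where G: "\<And>b. smooth_on (ball (\<psi> p) R) (G b)"
      "\<And>b. G b (\<psi> p) = frechet_derivative ?F (at (\<psi> p)) b"
      "\<And>x. x \<in> ball (\<psi> p) R \<Longrightarrow> ?F x = ?F (\<psi> p) + (\<Sum>b\<in>Basis. ((x - \<psi> p) \<bullet> b) * G b x)"
      using hadamard[OF smooth_on_subset[OF smooth_functionsD[OF f chart] ball_subset]] by blast
    note lin = has_derivative_linear[OF chart_has_derivative[OF chart centre f]]
    have Gp: "G b (\<psi> p) = chart_derivative A U \<psi> p b f" for b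
      using G(2) f by (simp add: chart_derivative_def o_def)
    \<comment> \<open>Two bump factors, because each product of \<open>coord b\<close> and
      \<open>cutoff (G b)\<close> carries two.\<close>
    define z where "z = (\<lambda>q. cutoff (\<lambda>_. 1) q * cutoff (\<lambda>_. 1) q)"
    have z: "z \<in> smooth_functions A"
      unfolding z_def by (intro smooth_functions_mult cutoff_smooth smooth_on_const)
    have cG: "cutoff (G b) \<in> smooth_functions A" for b
      by (rule cutoff_smooth[OF G(1)])
    have prod: "(\<lambda>q. coord b q * cutoff (G b) q) \<in> smooth_functions A" for b
      by (intro smooth_functions_mult coord_smooth cG)
    have "z q * f q = f p * z q + (\<Sum>b\<in>Basis. coord b q * cutoff (G b) q)" for q
    proof (cases "q \<in> U \<and> \<psi> q \<in> ball (\<psi> p) R")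
      case True
      then have "f q = f p + (\<Sum>b\<in>Basis. ((\<psi> q - \<psi> p) \<bullet> b) * G b (\<psi> q))"
        using G(3)[of "\<psi> q"] chart_inverse[OF chart] centre by simp
      then show ?thesis
        using True by (simp add: z_def coord_def cutoff_def algebra_simps sum_distrib_left)
    next
      case False
      then have "cutoff H q = 0" for H unfolding cutoff_def by auto
      then show ?thesis by (simp add: z_def)
    qed
    then have "v (\<lambda>q. z q * f q) = v (\<lambda>q. f p * z q + (\<Sum>b\<in>Basis. coord b q * cutoff (G b) q))"
      by presburger
    also have "\<dots> = f p * v z + (\<Sum>b\<in>Basis. v (\<lambda>q. coord b q * cutoff (G b) q))"
      using tangent_vector_sum[OF v prod, of "\<lambda>b. b" Basis] tangent_spaceD(1)[OF v smooth_functions_scale[OF z]]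
        tangent_spaceD(2)[OF v z] by simp
    also have "(\<Sum>b\<in>Basis. v (\<lambda>q. coord b q * cutoff (G b) q))
        = (\<Sum>b\<in>Basis. peak * chart_derivative A U \<psi> p b f * v (coord b))"
      using tangent_spaceD(3)[OF v coord_smooth cG]
      by (simp add: coord_def cutoff_centre Gp)
    \<comment> \<open>On the left the Leibniz rule gives \<open>z p * v f + f p * v z\<close>; the
      last term cancels against the right side, and \<open>z p\<close> is
      \<open>peak * peak\<close>. In the sum only the terms
      \<open>cutoff (G b) p * v (coord b)\<close> survived, as \<open>coord b\<close> vanishes at
      \<open>p\<close>.\<close>
    finally have "peak * peak * v f = (\<Sum>b\<in>Basis. peak * chart_derivative A U \<psi> p b f * v (coord b))"
      using tangent_spaceD(3)[OF v z f] by (simp add: z_def cutoff_centre)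
    then have "peak * peak * v f = peak * peak * (\<Sum>b\<in>Basis. (v (coord b) / peak) * chart_derivative A U \<psi> p b f)"
      using peak_pos by (simp add: sum_distrib_left mult_ac)
    then have "v f = (\<Sum>b\<in>Basis. (v (coord b) / peak) * chart_derivative A U \<psi> p b f)"
      using peak_pos by simp
    also have "\<dots> = chart_derivative A U \<psi> p (\<Sum>b\<in>Basis. (v (coord b) / peak) *\<^sub>R b) f"
      by (simp add: linear_sum[OF lin] linear_scale[OF lin])
    finally show ?thesis .
  qed
qed

lemma range_chart_derivative: "range (chart_derivative A U \<psi> p) = tangent_space A p"
  using tangent_vector_eq_chart_derivative chart_derivative_tangent[OF chart centre] by blast

text \<open>The functions \<open>coord b\<close> detect the components of a vector up to the factor
  \<open>peak\<close>.\<close>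

lemma inj_chart_derivative: "inj (chart_derivative A U \<psi> p)"
proof (rule linear_injective_0[THEN iffD2, OF linear_chart_derivative[OF chart centre]], intro allI impI)
  fix w assume "chart_derivative A U \<psi> p w = 0"
  then have "peak * (w \<bullet> b) = 0" for b
    using chart_derivative_coord[of w b] by simp
  then show "w = 0" using peak_pos by (simp add: euclidean_eq_iff[of w])
qed

text \<open>Take constant components \<open>w\<close> in the chart and damp them by a cutoff; the
  constant \<open>1 / peak\<close> makes the damping factor 1 at \<open>p\<close>.\<close>

lemma chart_derivative_extension:
  "\<exists>X\<in>vector_fields A. X p = chart_derivative A U \<psi> p w"
proof -
  define X where "X = (\<lambda>q. cutoff (\<lambda>_. 1 / peak) q *\<^sub>R chart_derivative A U \<psi> q w)"
  have "X p = chart_derivative A U \<psi> p w"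
    using peak_pos by (simp add: X_def cutoff_centre)
  have "X q \<in> tangent_space A q" for q
  proof (cases "q \<in> U")
    case True
    then show ?thesis
      unfolding X_def by (intro subspace_scale[OF subspace_tangent_space] chart_derivative_tangent[OF chart])
  next
    case False
    then have "X q = 0" by (simp add: X_def cutoff_def)
    then show ?thesis using subspace_0[OF subspace_tangent_space] by simp
  qed
  moreover have "(\<lambda>q. X q f) \<in> smooth_functions A" if f: "f \<in> smooth_functions A" for f
  proof -
    let ?D = "\<lambda>x. frechet_derivative (\<lambda>x. f (inv_into U \<psi> x)) (at x) w"
    have "smooth_on (ball (\<psi> p) R) (\<lambda>x. 1 / peak * ?D x)"
      by (intro smooth_on_mult smooth_on_const open_ball
          smooth_on_subset[OF smooth_on_frechet_derivative[OF smooth_functionsD[OF f chart]] ball_subset])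
    then have "cutoff (\<lambda>x. 1 / peak * ?D x) \<in> smooth_functions A" by (rule cutoff_smooth)
    moreover have "X q f = cutoff (\<lambda>x. 1 / peak * ?D x) q" for q
      using f by (simp add: X_def scaleR_fun_def cutoff_def chart_derivative_def o_def)
    ultimately show ?thesis by presburger
  qed
  ultimately have "X \<in> vector_fields A" by (simp add: vector_fields_def)
  with \<open>X p = _\<close> show ?thesis by blast
qed

end

section \<open>Bases of tangent spaces and extension of vectors to fields\<close>

context smooth_manifold
begin

lemma chart_ball_at: obtains U \<psi> R where "chart_ball A U \<psi> p R"
proof -
  obtain U \<psi> where U: "(U, \<psi>) \<in> A" "p \<in> U" by (rule chart_at)
  then obtain R where "R > 0" "ball (\<psi> p) R \<subseteq> \<psi> ` U"
    using open_chart_image[OF U(1)] by (meson image_eqI open_contains_ball)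
  then have "chart_ball A U \<psi> p R" using U by unfold_locales auto
  then show ?thesis by (rule that)
qed

text \<open>The chart derivative is a linear isomorphism from the model space, so the image of
  \<open>Basis\<close> serves.\<close>

lemma tangent_space_basis:
  obtains B where "finite B" "independent B" "card B = DIM('e)" "span B = tangent_space A p"
proof -
  obtain U \<psi> R where "chart_ball A U \<psi> p R" by (rule chart_ball_at)
  then interpret chart_ball A U \<psi> p R .
  let ?d = "chart_derivative A U \<psi> p"
  have lin: "linear ?d" by (rule linear_chart_derivative[OF chart centre])
  have inj: "inj_on ?d S" for S using inj_chart_derivative by (rule inj_on_subset) simp
  show ?thesis
  proof
    show "finite (?d ` Basis)" by simp
    show "independent (?d ` Basis)"
      by (rule linear_independent_injective_image[OF lin independent_Basis inj])
    show "card (?d ` Basis) = DIM('e)" by (rule card_image[OF inj])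
    show "span (?d ` Basis) = tangent_space A p"
      by (simp add: linear_span_image[OF lin] range_chart_derivative)
  qed
qed

lemma extension_vector_field:
  assumes "v \<in> tangent_space A p"
  shows "extension A p v \<in> vector_fields A" and "extension A p v p = v"
proof -
  obtain U \<psi> R where "chart_ball A U \<psi> p R" by (rule chart_ball_at)
  then interpret chart_ball A U \<psi> p R .
  have "\<exists>X. X \<in> vector_fields A \<and> X p = v"
    using chart_derivative_extension tangent_vector_eq_chart_derivative[OF assms] by metis
  from someI_ex[OF this] show "extension A p v \<in> vector_fields A" "extension A p v p = v"
    by (simp_all add: extension_def)
qed

end

section \<open>Para-Sasaki-like manifolds\<close>

lemma scaleR_fun_apply: "(r *\<^sub>R f) x = r *\<^sub>R f x"
  by (simp add: scaleR_fun_def)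

context smooth_manifold
begin

text \<open>From 1 = 1 * 1 the Leibniz rule gives v(1) = 2 v(1).\<close>

lemma tangent_vector_const:
  assumes v: "v \<in> tangent_space A p" shows "v (\<lambda>q. r) = 0"
  using tangent_spaceD(3)[OF v smooth_functions_const smooth_functions_const, of 1 1]
    tangent_spaceD(2)[OF v smooth_functions_const, of r 1] by simp

lemma vector_fieldsI:
  "(\<And>p. X p \<in> tangent_space A p) \<Longrightarrow>
   (\<And>f. f \<in> smooth_functions A \<Longrightarrow> (\<lambda>p. X p f) \<in> smooth_functions A) \<Longrightarrow> X \<in> vector_fields A"
  by (simp add: vector_fields_def)

lemma vector_fieldsD: "X \<in> vector_fields A \<Longrightarrow> X p \<in> tangent_space A p"
  by (simp add: vector_fields_def)

lemma vector_fields_zero: "0 \<in> vector_fields A"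
  by (rule vector_fieldsI) (simp_all add: subspace_0[OF subspace_tangent_space] smooth_functions_const)

lemma vector_fields_add:
  "X \<in> vector_fields A \<Longrightarrow> Y \<in> vector_fields A \<Longrightarrow> X + Y \<in> vector_fields A"
  by (rule vector_fieldsI)
    (simp_all add: subspace_add[OF subspace_tangent_space] smooth_functions_add vector_fields_def)

lemma vector_fields_scale:
  "f \<in> smooth_functions A \<Longrightarrow> X \<in> vector_fields A \<Longrightarrow> (\<lambda>p. f p *\<^sub>R X p) \<in> vector_fields A"
  by (rule vector_fieldsI)
    (simp_all add: subspace_scale[OF subspace_tangent_space] smooth_functions_mult vector_fields_def
      scaleR_fun_apply)

lemma vector_fields_diff:
  assumes "X \<in> vector_fields A" "Y \<in> vector_fields A"
  shows "X - Y \<in> vector_fields A"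
  using assms by (intro vector_fieldsI)
    (simp_all add: subspace_diff[OF subspace_tangent_space] smooth_functions_diff vector_fields_def)

end

section \<open>Pointwise algebra of the structure tensors\<close>

locale para_Sasaki_manifold =
  fixes A :: "('m::{t2_space, second_countable_topology}, 'e::euclidean_space) chart set"
    and \<phi> :: "'m \<Rightarrow> 'm tangent_vector \<Rightarrow> 'm tangent_vector"
    and \<xi> :: "'m vector_field"
    and \<eta> :: "'m \<Rightarrow> 'm tangent_vector \<Rightarrow> real"
    and g :: "'m \<Rightarrow> 'm tangent_vector \<Rightarrow> 'm tangent_vector \<Rightarrow> real"
    and D :: "'m connection"
    and n :: nat
  assumes levi_civita: "levi_civita_connection A g D"
    and para_Sasaki: "para_Sasaki_like n A \<phi> \<xi> \<eta> g D"
begin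

abbreviation "T \<equiv> tangent_space A"
abbreviation "VF \<equiv> vector_fields A"

lemma apapR: "apapR_manifold n A \<phi> \<xi> \<eta> g"
  using para_Sasaki by (simp add: para_Sasaki_like_def)

end

sublocale para_Sasaki_manifold \<subseteq> smooth_manifold A
  using apapR by unfold_locales (simp add: apapR_manifold_def)

context para_Sasaki_manifold
begin

lemma dim_eq: "DIM('e) = 2 * n + 1"
  using apapR by (simp add: apapR_manifold_def)

lemma T_closed [simp]:
  "0 \<in> T p" "u \<in> T p \<Longrightarrow> v \<in> T p \<Longrightarrow> u + v \<in> T p" "u \<in> T p \<Longrightarrow> v \<in> T p \<Longrightarrow> u - v \<in> T p"
  "u \<in> T p \<Longrightarrow> - u \<in> T p" "u \<in> T p \<Longrightarrow> r *\<^sub>R u \<in> T p"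
  "(\<And>i. i \<in> I \<Longrightarrow> h i \<in> T p) \<Longrightarrow> sum h I \<in> T p"
  using subspace_tangent_space
  by (simp_all add: subspace_0 subspace_add subspace_diff subspace_neg subspace_scale subspace_sum)

lemma VF_T [simp]: "X \<in> VF \<Longrightarrow> X p \<in> T p"
  by (rule vector_fieldsD)

lemma xi_VF [simp]: "\<xi> \<in> VF"
  using apapR by (simp add: apapR_manifold_def)

lemma xi_T [simp]: "\<xi> p \<in> T p"
  by simp

lemma phi_T [simp]: "u \<in> T p \<Longrightarrow> \<phi> p u \<in> T p"
  using apapR by (auto simp: apapR_manifold_def endomorphism_field_def)

lemma phi_VF [simp]: "X \<in> VF \<Longrightarrow> (\<lambda>p. \<phi> p (X p)) \<in> VF"
  using apapR by (auto simp: apapR_manifold_def endomorphism_field_def)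

lemma phi_add [simp]: "u \<in> T p \<Longrightarrow> v \<in> T p \<Longrightarrow> \<phi> p (u + v) = \<phi> p u + \<phi> p v"
  and phi_scale [simp]: "u \<in> T p \<Longrightarrow> \<phi> p (r *\<^sub>R u) = r *\<^sub>R \<phi> p u"
  using apapR by (simp_all add: apapR_manifold_def endomorphism_field_def linear_map_on_def)

lemma phi_minus [simp]: "u \<in> T p \<Longrightarrow> \<phi> p (- u) = - \<phi> p u"
  using phi_scale[of u p "-1"] by simp

lemma phi_diff [simp]: "u \<in> T p \<Longrightarrow> v \<in> T p \<Longrightarrow> \<phi> p (u - v) = \<phi> p u - \<phi> p v"
  using phi_add[of u p "- v"] by simp

lemma phi_xi [simp]: "\<phi> p (\<xi> p) = 0"
  and eta_xi [simp]: "\<eta> p (\<xi> p) = 1"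
  and phi_phi [simp]: "u \<in> T p \<Longrightarrow> \<phi> p (\<phi> p u) = u - \<eta> p u *\<^sub>R \<xi> p"
  and trace_phi: "trace_on (T p) (\<phi> p) = 0"
  and g_phi_phi: "u \<in> T p \<Longrightarrow> v \<in> T p \<Longrightarrow> g p (\<phi> p u) (\<phi> p v) = g p u v - \<eta> p u * \<eta> p v"
  using apapR by (simp_all add: apapR_manifold_def)

lemma g_commute: "u \<in> T p \<Longrightarrow> v \<in> T p \<Longrightarrow> g p u v = g p v u"
  and g_pos: "u \<in> T p \<Longrightarrow> u \<noteq> 0 \<Longrightarrow> g p u u > 0"
  and g_add_right [simp]: "u \<in> T p \<Longrightarrow> v \<in> T p \<Longrightarrow> w \<in> T p \<Longrightarrow> g p u (v + w) = g p u v + g p u w"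
  and g_scale_right [simp]: "u \<in> T p \<Longrightarrow> v \<in> T p \<Longrightarrow> g p u (r *\<^sub>R v) = r * g p u v"
  using apapR by (simp_all add: apapR_manifold_def riemannian_metric_def linear_map_on_def)

lemma g_add_left [simp]: "u \<in> T p \<Longrightarrow> v \<in> T p \<Longrightarrow> w \<in> T p \<Longrightarrow> g p (v + w) u = g p v u + g p w u"
  and g_scale_left [simp]: "u \<in> T p \<Longrightarrow> v \<in> T p \<Longrightarrow> g p (r *\<^sub>R v) u = r * g p v u"
  using g_commute[of _ p u] by simp_all

lemma g_minus [simp]:
  "u \<in> T p \<Longrightarrow> v \<in> T p \<Longrightarrow> g p u (- v) = - g p u v" "u \<in> T p \<Longrightarrow> v \<in> T p \<Longrightarrow> g p (- v) u = - g p v u"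
  using g_scale_right[of u p v "-1"] g_scale_left[of u p v "-1"] by simp_all

lemma g_diff [simp]:
  "u \<in> T p \<Longrightarrow> v \<in> T p \<Longrightarrow> w \<in> T p \<Longrightarrow> g p u (v - w) = g p u v - g p u w"
  "u \<in> T p \<Longrightarrow> v \<in> T p \<Longrightarrow> w \<in> T p \<Longrightarrow> g p (v - w) u = g p v u - g p w u"
  using g_add_right[of u p v "- w"] g_add_left[of u p v "- w"] by simp_all

lemma g_zero [simp]: "u \<in> T p \<Longrightarrow> g p u 0 = 0" "u \<in> T p \<Longrightarrow> g p 0 u = 0"
  using g_scale_right[of u p u 0] g_scale_left[of u p u 0] by simp_all

lemma g_sum_left: "u \<in> T p \<Longrightarrow> (\<And>i. i \<in> I \<Longrightarrow> h i \<in> T p) \<Longrightarrow> g p (sum h I) u = (\<Sum>i\<in>I. g p (h i) u)"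
  by (induction I rule: infinite_finite_induct) auto

lemma phi_sum: "(\<And>i. i \<in> I \<Longrightarrow> h i \<in> T p) \<Longrightarrow> \<phi> p (sum h I) = (\<Sum>i\<in>I. \<phi> p (h i))"
  using phi_scale[of 0 p 0] by (induction I rule: infinite_finite_induct) auto

text \<open>Put v = \<xi> in \<open>g_phi_phi\<close>: the left side vanishes because \<phi> \<xi> =
  0.\<close>

lemma g_xi [simp]: "u \<in> T p \<Longrightarrow> g p u (\<xi> p) = \<eta> p u" "u \<in> T p \<Longrightarrow> g p (\<xi> p) u = \<eta> p u"
  using g_phi_phi[of u p "\<xi> p"] g_commute[of u p "\<xi> p"] by simp_all

lemma eta_linear [simp]:
  "u \<in> T p \<Longrightarrow> v \<in> T p \<Longrightarrow> \<eta> p (u + v) = \<eta> p u + \<eta> p v"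
  "u \<in> T p \<Longrightarrow> v \<in> T p \<Longrightarrow> \<eta> p (u - v) = \<eta> p u - \<eta> p v"
  "u \<in> T p \<Longrightarrow> \<eta> p (- u) = - \<eta> p u" "u \<in> T p \<Longrightarrow> \<eta> p (r *\<^sub>R u) = r * \<eta> p u"
  by (simp_all flip: g_xi(1))

lemma eta_zero [simp]: "\<eta> p 0 = 0"
  using eta_linear(4)[of "\<xi> p" p 0] by simp

text \<open>Evaluate the third power of \<phi> at \<open>u\<close> twice: apply \<phi> to
  \<open>phi_phi\<close> for \<open>u\<close>, or use \<open>phi_phi\<close> for \<phi> u. The
  results differ by \<eta>(\<phi> u) \<xi>.\<close>

lemma eta_phi [simp]: "u \<in> T p \<Longrightarrow> \<eta> p (\<phi> p u) = 0"
proof -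
  assume u: "u \<in> T p"
  have "\<phi> p (\<phi> p (\<phi> p u)) = \<phi> p u" using u by simp
  moreover have "\<phi> p (\<phi> p (\<phi> p u)) = \<phi> p u - \<eta> p (\<phi> p u) *\<^sub>R \<xi> p" using u by (intro phi_phi) simp
  ultimately have "\<eta> p (\<phi> p u) *\<^sub>R \<xi> p = 0" by simp
  then have "\<eta> p (\<eta> p (\<phi> p u) *\<^sub>R \<xi> p) = 0" by (simp only: eta_zero)
  then show ?thesis by simp
qed

text \<open>Replace v by \<phi> v in \<open>g_phi_phi\<close>; the terms with \<xi> vanish by
  \<open>eta_phi\<close>. As a rewrite rule it moves \<phi> to the second argument, the normal form
  used from here on.\<close>

lemma g_phi_left [simp]: "u \<in> T p \<Longrightarrow> v \<in> T p \<Longrightarrow> g p (\<phi> p u) v = g p u (\<phi> p v)"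
  using g_phi_phi[of u p "\<phi> p v"] by simp

subsection \<open>Adapted orthonormal bases\<close>

text \<open>The functional g(e i, -) kills the span of the other members but not e i.\<close>

lemma orthonormal_independent:
  assumes e: "e ` {0..k::nat} \<subseteq> T p"
    and on: "\<forall>i\<in>{0..k}. \<forall>j\<in>{0..k}. g p (e i) (e j) = (if i = j then 1 else 0)"
  shows "independent (e ` {0..k})" and "card (e ` {0..k}) = k + 1"
proof -
  have "inj_on e {0..k}"
    by (rule inj_onI) (metis on zero_neq_one)
  then show "card (e ` {0..k}) = k + 1" by (simp add: card_image)
  show "independent (e ` {0..k})"
  proof
    assume "dependent (e ` {0..k})"
    then obtain i where i: "i \<in> {0..k}" "e i \<in> span (e ` {0..k} - {e i})"
      unfolding dependent_def by blast
    have "span (e ` {0..k} - {e i}) \<subseteq> {u \<in> T p. g p (e i) u = 0}"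
    proof (rule span_minimal)
      show "e ` {0..k} - {e i} \<subseteq> {u \<in> T p. g p (e i) u = 0}"
        using on i e by (auto simp: image_subset_iff)
      show "subspace {u \<in> T p. g p (e i) u = 0}"
        using i e by (auto simp: subspace_def image_subset_iff)
    qed
    then have "g p (e i) (e i) = 0" using i by blast
    then show False using on i by auto
  qed
qed

text \<open>Gram-Schmidt started at the unit vector \<xi>. As long as fewer than 2 n + 1 vectors are
  chosen, counting against a basis yields a vector outside their span.\<close>

lemma orthonormal_family:
  "k \<le> 2 * n \<Longrightarrow> \<exists>e. e 0 = \<xi> p \<and> e ` {0..k} \<subseteq> T p \<and>
     (\<forall>i\<in>{0..k}. \<forall>j\<in>{0..k}. g p (e i) (e j) = (if i = j then 1 else 0))"
proof (induction k)
  case 0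
  show ?case by (rule exI[of _ "\<lambda>_. \<xi> p"]) auto
next
  case (Suc k)
  then obtain e where e0: "e 0 = \<xi> p" and e: "e ` {0..k} \<subseteq> T p"
    and on: "\<forall>i\<in>{0..k}. \<forall>j\<in>{0..k}. g p (e i) (e j) = (if i = j then 1 else 0)" by auto
  obtain B where B: "finite B" "independent B" "card B = 2 * n + 1" "span B = T p"
    using tangent_space_basis dim_eq by metis
  have "\<not> T p \<subseteq> span (e ` {0..k})"
  proof
    assume "T p \<subseteq> span (e ` {0..k})"
    then have "B \<subseteq> span (e ` {0..k})" using B span_superset by blast
    from independent_span_bound[OF _ B(2) this] have "card B \<le> k + 1"
      using orthonormal_independent(2)[OF e on] by simp
    then show False using B Suc.prems by simp
  qed
  then obtain u where u: "u \<in> T p" "u \<notin> span (e ` {0..k})" by blast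
  have eT: "e i \<in> T p" if "i \<in> {0..k}" for i using e that by blast
  define s where "s = (\<Sum>i\<in>{0..k}. g p u (e i) *\<^sub>R e i)"
  define w where "w = u - s"
  have s: "s \<in> T p" "s \<in> span (e ` {0..k})"
    unfolding s_def
    by (rule T_closed, rule T_closed, rule eT, assumption)
      (intro span_sum span_scale span_base imageI)
  have w: "w \<in> T p" "w \<noteq> 0" using u s by (auto simp: w_def)
  have gw: "g p w (e j) = 0" if j: "j \<in> {0..k}" for j
  proof -
    have "g p s (e j) = (\<Sum>i\<in>{0..k}. g p (g p u (e i) *\<^sub>R e i) (e j))"
      unfolding s_def by (rule g_sum_left) (use eT j in auto)
    also have "\<dots> = (\<Sum>i\<in>{0..k}. if i = j then g p u (e i) else 0)"
      by (rule sum.cong) (use eT j on in auto)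
    also have "\<dots> = g p u (e j)" using j by simp
    finally show ?thesis using u s eT[OF j] by (simp add: w_def)
  qed
  define v where "v = (1 / sqrt (g p w w)) *\<^sub>R w"
  have v: "v \<in> T p" using w by (simp add: v_def)
  have gv: "g p v (e j) = 0" "g p (e j) v = 0" if "j \<in> {0..k}" for j
    using gw[OF that] g_commute[OF v eT[OF that]] w eT[OF that] by (simp_all add: v_def)
  have "g p v v = g p w w / (sqrt (g p w w) * sqrt (g p w w))"
    using w by (simp add: v_def)
  then have vv: "g p v v = 1" using g_pos[OF w] by simp
  show ?case
  proof (intro exI[of _ "e(Suc k := v)"] conjI ballI)
    show "(e(Suc k := v)) 0 = \<xi> p" using e0 by simp
    show "(e(Suc k := v)) ` {0..Suc k} \<subseteq> T p"
      using e v by (auto simp: image_subset_iff)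
    fix i j assume "i \<in> {0..Suc k}" "j \<in> {0..Suc k}"
    then show "g p ((e(Suc k := v)) i) ((e(Suc k := v)) j) = (if i = j then 1 else 0)"
      using on gv vv by (auto simp: le_Suc_eq)
  qed
qed

text \<open>A vector outside the span of 2 n + 1 orthonormal ones would give an independent set
  larger than a basis. This makes the choice of the frame in \<open>ricci\<close>
  meaningful.\<close>

lemma adapted_orthonormal_basis_exists: "\<exists>e. adapted_orthonormal_basis n A \<xi> g p e"
proof -
  obtain e where e0: "e 0 = \<xi> p" and e: "e ` {0..2 * n} \<subseteq> T p"
    and on: "\<forall>i\<in>{0..2 * n}. \<forall>j\<in>{0..2 * n}. g p (e i) (e j) = (if i = j then 1 else 0)"
    using orthonormal_family[of "2 * n" p] by blast
  obtain B where B: "finite B" "independent B" "card B = 2 * n + 1" "span B = T p"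
    using tangent_space_basis dim_eq by metis
  note ind = orthonormal_independent[OF e on]
  have "span (e ` {0..2 * n}) = T p"
  proof
    show "span (e ` {0..2 * n}) \<subseteq> T p"
      by (rule span_minimal[OF e subspace_tangent_space])
    show "T p \<subseteq> span (e ` {0..2 * n})"
    proof
      fix u assume u: "u \<in> T p"
      show "u \<in> span (e ` {0..2 * n})"
      proof (rule ccontr)
        assume *: "u \<notin> span (e ` {0..2 * n})"
        have "card (insert u (e ` {0..2 * n})) \<le> card B"
          using independent_span_bound[OF B(1) independent_insertI[OF * ind(1)]] u e B by auto
        moreover have "u \<notin> e ` {0..2 * n}" using * by (rule contrapos_nn) (rule span_base)
        ultimately show False using ind(2) B(3) by simp
      qed
    qed
  qed
  then show ?thesis using e0 e on by (auto simp: adapted_orthonormal_basis_def)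
qed

context
  fixes p :: 'm and e :: "nat \<Rightarrow> 'm tangent_vector"
  assumes adapted: "adapted_orthonormal_basis n A \<xi> g p e"
begin

lemma frame_T [simp]: "i \<le> 2 * n \<Longrightarrow> e i \<in> T p"
  using adapted by (auto simp: adapted_orthonormal_basis_def image_subset_iff)

lemma frame_orthonormal: "i \<le> 2 * n \<Longrightarrow> j \<le> 2 * n \<Longrightarrow> g p (e i) (e j) = (if i = j then 1 else 0)"
  using adapted by (auto simp: adapted_orthonormal_basis_def)

text \<open>The vectors with this expansion form a subspace that contains the frame.\<close>

lemma frame_expansion:
  assumes "u \<in> T p" shows "u = (\<Sum>i=0..2*n. g p (e i) u *\<^sub>R e i)"
proof -
  let ?S = "{u \<in> T p. u = (\<Sum>i=0..2*n. g p (e i) u *\<^sub>R e i)}"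
  have "span (e ` {0..2 * n}) \<subseteq> ?S"
  proof (rule span_minimal)
    show "e ` {0..2 * n} \<subseteq> ?S"
    proof (rule image_subsetI)
      fix j assume j: "j \<in> {0..2 * n}"
      have "(\<Sum>i=0..2*n. g p (e i) (e j) *\<^sub>R e i) = (\<Sum>i=0..2*n. if i = j then e i else 0)"
        by (rule sum.cong) (use j in \<open>auto simp: frame_orthonormal\<close>)
      then show "e j \<in> ?S" using j by simp
    qed
    show "subspace ?S"
      unfolding subspace_def
    proof (intro conjI ballI allI)
      fix u v :: "'m tangent_vector" and r :: real
      assume u: "u \<in> ?S"
      have "(\<Sum>i=0..2*n. g p (e i) (r *\<^sub>R u) *\<^sub>R e i) = r *\<^sub>R (\<Sum>i=0..2*n. g p (e i) u *\<^sub>R e i)"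
        unfolding scaleR_sum_right by (rule sum.cong) (use u in auto)
      with u show "r *\<^sub>R u \<in> ?S" by auto
      assume v: "v \<in> ?S"
      have "(\<Sum>i=0..2*n. g p (e i) (u + v) *\<^sub>R e i) =
          (\<Sum>i=0..2*n. g p (e i) u *\<^sub>R e i) + (\<Sum>i=0..2*n. g p (e i) v *\<^sub>R e i)"
        unfolding sum.distrib[symmetric] by (rule sum.cong) (use u v in \<open>auto simp: scaleR_add_left\<close>)
      with u v show "u + v \<in> ?S" by auto
    qed simp
  qed
  then show ?thesis using assms adapted by (auto simp: adapted_orthonormal_basis_def)
qed

lemma parseval:
  assumes "u \<in> T p" "v \<in> T p"
  shows "(\<Sum>i=0..2*n. g p (e i) u * g p (e i) v) = g p u v"
proof -
  have "g p u v = g p (\<Sum>i=0..2*n. g p (e i) u *\<^sub>R e i) v"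
    using frame_expansion[OF assms(1)] by simp
  also have "\<dots> = (\<Sum>i=0..2*n. g p (g p (e i) u *\<^sub>R e i) v)"
    by (rule g_sum_left) (use assms in auto)
  also have "\<dots> = (\<Sum>i=0..2*n. g p (e i) u * g p (e i) v)"
    by (rule sum.cong) (use assms in auto)
  finally show ?thesis by simp
qed

text \<open>Expanding e i in the basis \<open>B\<close> chosen by \<open>trace_on\<close>, and
  \<phi> b in the frame, turns both traces into the same double sum.\<close>

lemma trace_frame: "(\<Sum>i=0..2*n. g p (e i) (\<phi> p (e i))) = 0"
proof -
  obtain B0 where B0: "finite B0" "independent B0" "span B0 = T p"
    using tangent_space_basis by metis
  define B where "B = (SOME B. independent B \<and> span B = T p)"
  have B: "independent B" "span B = T p"
    using someI[of "\<lambda>B. independent B \<and> span B = T p" B0] B0 by (simp_all add: B_def)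
  \<comment> \<open>The choice only guarantees an independent spanning set; finiteness follows by
    comparison with \<open>B0\<close>.\<close>
  have fin: "finite B"
    using independent_span_bound[OF B0(1) B(1)] B B0 span_superset by auto
  have BT: "b \<in> T p" if "b \<in> B" for b using that B span_base by blast
  have rep: "representation B (\<phi> p b) b = (\<Sum>i=0..2*n. g p (e i) (\<phi> p b) * representation B (e i) b)"
    if b: "b \<in> B" for b
  proof -
    have "representation B (\<phi> p b) = representation B (\<Sum>i=0..2*n. g p (e i) (\<phi> p b) *\<^sub>R e i)"
      using frame_expansion[of "\<phi> p b"] BT[OF b] by simp
    also have "\<dots> = (\<lambda>b'. \<Sum>i=0..2*n. representation B (g p (e i) (\<phi> p b) *\<^sub>R e i) b')"
      by (rule real_vector.representation_sum[OF B(1)]) (auto simp: B)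
    also have "\<dots> = (\<lambda>b'. \<Sum>i=0..2*n. g p (e i) (\<phi> p b) * representation B (e i) b')"
      by (intro ext sum.cong) (auto simp: real_vector.representation_scale[OF B(1)] B)
    finally show ?thesis by (rule fun_cong)
  qed
  have "(\<Sum>i=0..2*n. g p (e i) (\<phi> p (e i)))
      = (\<Sum>i=0..2*n. \<Sum>b\<in>B. g p (e i) (\<phi> p b) * representation B (e i) b)"
  proof (rule sum.cong)
    fix i assume i: "i \<in> {0..2*n}"
    then have eq: "e i = (\<Sum>b\<in>B. representation B (e i) b *\<^sub>R b)"
      using real_vector.sum_representation_eq[OF B(1) _ fin] B by simp
    have phi_e: "\<phi> p (e i) = (\<Sum>b\<in>B. representation B (e i) b *\<^sub>R \<phi> p b)"
      by (subst eq, subst phi_sum) (auto simp: BT intro!: sum.cong)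
    have "g p (e i) (\<phi> p (e i)) = g p (\<phi> p (e i)) (e i)" using i by simp
    also have "\<dots> = (\<Sum>b\<in>B. g p (representation B (e i) b *\<^sub>R \<phi> p b) (e i))"
      unfolding phi_e by (rule g_sum_left) (use i BT in auto)
    also have "\<dots> = (\<Sum>b\<in>B. g p (e i) (\<phi> p b) * representation B (e i) b)"
      by (rule sum.cong) (use i BT in \<open>auto simp: g_commute[of _ p "e i"] mult.commute simp del: g_phi_left\<close>)
    finally show "g p (e i) (\<phi> p (e i)) = (\<Sum>b\<in>B. g p (e i) (\<phi> p b) * representation B (e i) b)" .
  qed simp
  also have "\<dots> = (\<Sum>b\<in>B. representation B (\<phi> p b) b)"
    by (subst sum.swap) (simp add: rep)
  also have "\<dots> = 0"
    using trace_phi[of p] by (simp add: trace_on_def B_def Let_def)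
  finally show ?thesis .
qed

end

end

section \<open>Curvature of the generalized symmetric metric connection\<close>

context para_Sasaki_manifold
begin

section \<open>Levi-Civita derivatives of the structure tensors\<close>

lemma D_VF [simp]: "X \<in> VF \<Longrightarrow> Y \<in> VF \<Longrightarrow> D X Y \<in> VF"
  and D_add_right: "X \<in> VF \<Longrightarrow> Y \<in> VF \<Longrightarrow> Z \<in> VF \<Longrightarrow> D X (Y + Z) = D X Y + D X Z"
  and D_scale_right: "f \<in> smooth_functions A \<Longrightarrow> X \<in> VF \<Longrightarrow> Y \<in> VF \<Longrightarrow>
    D X (\<lambda>p. f p *\<^sub>R Y p) = (\<lambda>p. X p f *\<^sub>R Y p + f p *\<^sub>R D X Y p)"
  and lie_bracket_D: "X \<in> VF \<Longrightarrow> Y \<in> VF \<Longrightarrow> lie_bracket X Y = D X Y - D Y X"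
  and D_metric: "X \<in> VF \<Longrightarrow> Y \<in> VF \<Longrightarrow> Z \<in> VF \<Longrightarrow>
    X p (\<lambda>q. g q (Y q) (Z q)) = g p (D X Y p) (Z p) + g p (Y p) (D X Z p)"
  using levi_civita by (simp_all add: levi_civita_connection_def affine_connection_def)

lemma D_zero_right: "X \<in> VF \<Longrightarrow> D X 0 = 0"
  using D_add_right[of X 0 0] vector_fields_zero by simp

lemma g_smooth: "X \<in> VF \<Longrightarrow> Y \<in> VF \<Longrightarrow> (\<lambda>q. g q (X q) (Y q)) \<in> smooth_functions A"
  using apapR by (simp add: apapR_manifold_def riemannian_metric_def)

lemma eta_smooth: "X \<in> VF \<Longrightarrow> (\<lambda>q. \<eta> q (X q)) \<in> smooth_functions A"
  using apapR by (simp add: apapR_manifold_def one_form_def)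

lemma D_phi:
  assumes "X \<in> VF" "Y \<in> VF"
  shows "D X (\<lambda>q. \<phi> q (Y q)) p = \<phi> p (D X Y p) - g p (X p) (Y p) *\<^sub>R \<xi> p - \<eta> p (Y p) *\<^sub>R X p
    + (2 * \<eta> p (X p) * \<eta> p (Y p)) *\<^sub>R \<xi> p"
proof -
  have "covariant_derivative_endo D \<phi> X Y p = - (g p (X p) (Y p) *\<^sub>R \<xi> p) - \<eta> p (Y p) *\<^sub>R X p
    + (2 * \<eta> p (X p) * \<eta> p (Y p)) *\<^sub>R \<xi> p"
    using para_Sasaki assms by (simp add: para_Sasaki_like_def)
  then show ?thesis by (simp add: covariant_derivative_endo_def algebra_simps)
qed

text \<open>Put Y = \<xi> in \<open>D_phi\<close>: since \<phi> \<xi> = 0, the vectors D_X \<xi> and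
  \<phi> X have the same image under \<phi>, hence differ by a multiple of \<xi>. That multiple is
  0, because g(\<xi>, \<xi>) is constant and so \<eta>(D_X \<xi>) = 0.\<close>

lemma D_xi [simp]:
  assumes X: "X \<in> VF"
  shows "D X \<xi> p = \<phi> p (X p)"
proof -
  have "(\<lambda>q. \<phi> q (\<xi> q)) = 0" by (simp add: fun_eq_iff)
  then have "0 = \<phi> p (D X \<xi> p) - \<eta> p (X p) *\<^sub>R \<xi> p - X p + (2 * \<eta> p (X p)) *\<^sub>R \<xi> p"
    using D_phi[OF X xi_VF, of p] D_zero_right[OF X] X by simp
  then have "\<phi> p (D X \<xi> p) = X p + \<eta> p (X p) *\<^sub>R \<xi> p - (2 * \<eta> p (X p)) *\<^sub>R \<xi> p"
    by (simp add: algebra_simps)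
  also have "\<dots> = X p - \<eta> p (X p) *\<^sub>R \<xi> p"
    by (simp add: scaleR_2 flip: scaleR_scaleR)
  finally have "\<phi> p (\<phi> p (D X \<xi> p)) = \<phi> p (X p)" using X by simp
  moreover have "\<eta> p (D X \<xi> p) = 0"
    using D_metric[OF X xi_VF xi_VF, of p] tangent_vector_const[of "X p" p 1] X by simp
  ultimately show ?thesis using X by simp
qed

lemma derivative_eta:
  assumes "X \<in> VF" "Z \<in> VF"
  shows "X p (\<lambda>q. \<eta> q (Z q)) = \<eta> p (D X Z p) + g p (Z p) (\<phi> p (X p))"
  using D_metric[OF assms xi_VF, of p] assms by simp

section \<open>The deformed connection, its curvature and its traces\<close>

context
  fixes \<alpha> \<beta> :: real
begin

abbreviation "D' \<equiv> generalized_symmetric_connection \<phi> \<xi> \<eta> g D \<alpha> \<beta>"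

lemma D'_apply:
  assumes "X \<in> VF" "Y \<in> VF"
  shows "D' X Y p = D X Y p + (\<alpha> * g p (X p) (Y p) + \<beta> * g p (X p) (\<phi> p (Y p))) *\<^sub>R \<xi> p
    + (- \<alpha> * \<eta> p (Y p)) *\<^sub>R X p + (- \<beta> * \<eta> p (Y p)) *\<^sub>R \<phi> p (X p)"
  using assms by (simp add: generalized_symmetric_connection_def algebra_simps)

text \<open>Stated for whole fields, because \<open>D\<close> differentiates fields. The signs sit
  in the coefficients, so each added summand is a smooth function times a field, ready for
  additivity and the Leibniz rule of \<open>D\<close>.\<close>

lemma D'_decomposition:
  assumes "X \<in> VF" "Y \<in> VF"
  shows "D' X Y = ((D X Y + (\<lambda>p. (\<alpha> * g p (X p) (Y p) + \<beta> * g p (X p) (\<phi> p (Y p))) *\<^sub>R \<xi> p))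
    + (\<lambda>p. (- \<alpha> * \<eta> p (Y p)) *\<^sub>R X p)) + (\<lambda>p. (- \<beta> * \<eta> p (Y p)) *\<^sub>R \<phi> p (X p))"
  using D'_apply[OF assms] by (simp add: fun_eq_iff)

lemma summands_VF:
  assumes X: "X \<in> VF" and Y: "Y \<in> VF"
  shows "(\<lambda>p. (\<alpha> * g p (X p) (Y p) + \<beta> * g p (X p) (\<phi> p (Y p))) *\<^sub>R \<xi> p) \<in> VF"
    and "(\<lambda>p. (- \<alpha> * \<eta> p (Y p)) *\<^sub>R X p) \<in> VF"
    and "(\<lambda>p. (- \<beta> * \<eta> p (Y p)) *\<^sub>R \<phi> p (X p)) \<in> VF"
proof -
  note smooth = smooth_functions_scale[OF eta_smooth[OF Y]]
  show "(\<lambda>p. (\<alpha> * g p (X p) (Y p) + \<beta> * g p (X p) (\<phi> p (Y p))) *\<^sub>R \<xi> p) \<in> VF"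
    by (intro vector_fields_scale smooth_functions_add smooth_functions_scale g_smooth X Y
        phi_VF xi_VF)
  show "(\<lambda>p. (- \<alpha> * \<eta> p (Y p)) *\<^sub>R X p) \<in> VF"
    by (rule vector_fields_scale[OF smooth X])
  show "(\<lambda>p. (- \<beta> * \<eta> p (Y p)) *\<^sub>R \<phi> p (X p)) \<in> VF"
    by (rule vector_fields_scale[OF smooth phi_VF[OF X]])
qed

lemma D'_VF [simp]: "X \<in> VF \<Longrightarrow> Y \<in> VF \<Longrightarrow> D' X Y \<in> VF"
  by (subst D'_decomposition, assumption, assumption)
     (intro vector_fields_add summands_VF D_VF; assumption)

text \<open>The \<xi>-coefficient is differentiated by metricity, the others by
  \<open>derivative_eta\<close>, and \<xi> itself by \<open>D_xi\<close>. Derivatives of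
  \<phi>-images stay unexpanded until \<open>curvature_D'\<close>.\<close>

lemma D_D':
  assumes X: "X \<in> VF" and Y: "Y \<in> VF" and Z: "Z \<in> VF"
  shows "D X (D' Y Z) p = D X (D Y Z) p
    + (\<alpha> * (g p (D X Y p) (Z p) + g p (Y p) (D X Z p))
       + \<beta> * (g p (D X Y p) (\<phi> p (Z p)) + g p (Y p) (D X (\<lambda>q. \<phi> q (Z q)) p))) *\<^sub>R \<xi> p
    + (\<alpha> * g p (Y p) (Z p) + \<beta> * g p (Y p) (\<phi> p (Z p))) *\<^sub>R \<phi> p (X p)
    + (- \<alpha> * (\<eta> p (D X Z p) + g p (Z p) (\<phi> p (X p)))) *\<^sub>R Y p + (- \<alpha> * \<eta> p (Z p)) *\<^sub>R D X Y p
    + (- \<beta> * (\<eta> p (D X Z p) + g p (Z p) (\<phi> p (X p)))) *\<^sub>R \<phi> p (Y p)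
    + (- \<beta> * \<eta> p (Z p)) *\<^sub>R D X (\<lambda>q. \<phi> q (Y q)) p"
proof -
  note XT = VF_T[OF X, of p]
  note smooth = g_smooth[OF Y Z] g_smooth[OF Y phi_VF[OF Z]] eta_smooth[OF Z]
  have h: "(\<lambda>p. \<alpha> * g p (Y p) (Z p) + \<beta> * g p (Y p) (\<phi> p (Z p))) \<in> smooth_functions A"
    by (intro smooth_functions_add smooth_functions_scale smooth)
  have Xh: "X p (\<lambda>p. \<alpha> * g p (Y p) (Z p) + \<beta> * g p (Y p) (\<phi> p (Z p)))
      = \<alpha> * X p (\<lambda>p. g p (Y p) (Z p)) + \<beta> * X p (\<lambda>p. g p (Y p) (\<phi> p (Z p)))"
    using smooth by (simp add: tangent_spaceD[OF XT] smooth_functions_scale)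
  have eta: "D X (\<lambda>q. (r * \<eta> q (Z q)) *\<^sub>R W q) p
      = (r * (\<eta> p (D X Z p) + g p (Z p) (\<phi> p (X p)))) *\<^sub>R W p + (r * \<eta> p (Z p)) *\<^sub>R D X W p"
    if "W \<in> VF" for r W
    by (simp only: D_scale_right[OF smooth_functions_scale[OF smooth(3)] X that]
        tangent_spaceD(2)[OF XT smooth(3)] derivative_eta[OF X Z])
  show ?thesis
    unfolding D'_decomposition[OF Y Z]
    using Xh eta[OF Y, of "- \<alpha>"] eta[OF phi_VF[OF Y], of "- \<beta>"] summands_VF[OF Y Z] X Y Z
    by (simp add: D_add_right vector_fields_add D_scale_right[OF h X xi_VF]
        D_metric[OF X Y Z] D_metric[OF X Y phi_VF[OF Z]])
qed

text \<open>\<open>gP p u v\<close> is \<open>g(P u, v)\<close>; \<open>\<phi>\<close> is moved to the right by self-adjointness.\<close>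

abbreviation gP :: "'m \<Rightarrow> 'm tangent_vector \<Rightarrow> 'm tangent_vector \<Rightarrow> real" where
  "gP p u v \<equiv> \<alpha> * g p u v + \<beta> * g p u (\<phi> p v)"

text \<open>With S and P as in the overview, paired with \<open>w\<close>: the first line comes from
  D P = \<beta> D \<phi>, the second from D_x \<xi> = \<phi> x, the third from (D_x \<eta>)(z) =
  g(\<phi> x, z). The last three are S(x, S(y, z)) - S(y, S(x, z)), where the symmetric g(P x, P y)
  has cancelled.\<close>

definition curvature_difference ::
  "'m \<Rightarrow> 'm tangent_vector \<Rightarrow> 'm tangent_vector \<Rightarrow> 'm tangent_vector \<Rightarrow> 'm tangent_vector \<Rightarrow> real" where
  "curvature_difference p x y z w =
     \<beta> * ((\<eta> p x * g p y z - \<eta> p y * g p x z) * \<eta> p w - (\<eta> p x * g p y w - \<eta> p y * g p x w) * \<eta> p z)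
     + gP p y z * g p x (\<phi> p w) - gP p x z * g p y (\<phi> p w)
     - g p x (\<phi> p z) * gP p y w + g p y (\<phi> p z) * gP p x w
     + \<alpha> * (gP p y z * \<eta> p x - gP p x z * \<eta> p y) * \<eta> p w
     - (gP p y z - \<alpha> * \<eta> p y * \<eta> p z) * gP p x w
     + (gP p x z - \<alpha> * \<eta> p x * \<eta> p z) * gP p y w"

text \<open>The bracket is D_X Y - D_Y X. Hence the terms of D_X (S(Y, Z)) that differentiate the
  arguments cancel against S([X, Y], Z) and S(Y, D_X Z), likewise with X and Y exchanged, and an
  algebraic remainder is left.\<close>

lemma curvature_D':
  assumes X: "X \<in> VF" and Y: "Y \<in> VF" and Z: "Z \<in> VF" and w: "w \<in> T p"
  shows "g p (curvature D' X Y Z p) w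
    = g p (curvature D X Y Z p) w + curvature_difference p (X p) (Y p) (Z p) w"
proof -
  have flip: "g p (\<phi> p u) v = g p (\<phi> p v) u" if "u \<in> T p" "v \<in> T p" for u v
    using that g_commute[of "\<phi> p v" p u] by simp
  \<comment> \<open>\<open>g_phi_left\<close> fixes the place of \<phi> but not the order of the
    arguments; these equations select one order for each pair.\<close>
  have comm: "g p (Z p) (\<phi> p (X p)) = g p (X p) (\<phi> p (Z p))"
    "g p (Z p) (\<phi> p (Y p)) = g p (Y p) (\<phi> p (Z p))"
    "g p (Y p) (\<phi> p (X p)) = g p (X p) (\<phi> p (Y p))"
    "g p (Y p) (X p) = g p (X p) (Y p)"
    using flip[of "Z p" "X p"] flip[of "Z p" "Y p"] flip[of "Y p" "X p"]
      g_commute[of "Y p" p "X p"] X Y Z by simp_all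
  show ?thesis
    using X Y Z w
    by (simp add: curvature_def D'_apply D_D' D_phi lie_bracket_D vector_fields_diff comm)
      (simp add: curvature_difference_def algebra_simps power2_eq_square)
qed

text \<open>With x = w = e i, three kinds of terms remain: constants, counted 2 n + 1 times;
  multiples of g(e i, \<phi> (e i)), which sum to 0; and products of two components, summed by
  \<open>parseval\<close>.\<close>

lemma trace_curvature_difference:
  assumes e: "adapted_orthonormal_basis n A \<xi> g p e" and y: "y \<in> T p" and z: "z \<in> T p"
  shows "(\<Sum>i=0..2*n. curvature_difference p (e i) y z (e i))
    = ((1 - 2 * real n) * \<alpha>\<^sup>2 + \<beta>\<^sup>2 - \<beta>) * g p y z
      + ((2 * real n - 1) * \<alpha> + (2 - 2 * real n) * \<alpha> * \<beta>) * g p y (\<phi> p z)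
      + ((2 * real n + 1) * \<beta> + (2 * real n - 1) * \<alpha>\<^sup>2 - \<beta>\<^sup>2) * (\<eta> p y * \<eta> p z)"
proof -
  \<comment> \<open>A name for the components keeps their products in the shape that
    \<open>EE\<close> matches.\<close>
  define E where "E = (\<lambda>i u. g p (e i) u)"
  have EE: "(\<Sum>i=0..2*n. E i u * E i v) = g p u v" if "u \<in> T p" "v \<in> T p" for u v
    using parseval[OF e that] by (simp add: E_def)
  have F: "(\<Sum>i=0..2*n. E i (\<phi> p (e i))) = 0"
    using trace_frame[OF e] by (simp add: E_def)
  define P where "P = gP p y z"
  \<comment> \<open>\<open>Q\<close> is \<eta>(S(y, z)); the second term of S contributes - \<alpha>
    \<eta>(y) \<eta>(z).\<close>
  define Q where "Q = P - \<alpha> * \<eta> p y * \<eta> p z"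
  have "curvature_difference p (e i) y z (e i) =
      (\<beta> * \<eta> p y * \<eta> p z + \<alpha> * g p y (\<phi> p z) - \<alpha> * Q)
      + (P + \<beta> * g p y (\<phi> p z) - \<beta> * Q) * E i (\<phi> p (e i))
      + (\<beta> * g p y z + \<alpha> * P) * (E i (\<xi> p) * E i (\<xi> p))
      + (- (\<beta> + \<alpha>\<^sup>2) * \<eta> p y) * (E i z * E i (\<xi> p))
      + (- (\<beta> + \<alpha>\<^sup>2) * \<eta> p z) * (E i y * E i (\<xi> p))
      + (- \<alpha> * \<beta> * \<eta> p y) * (E i (\<phi> p z) * E i (\<xi> p))
      + (- \<alpha> * \<beta> * \<eta> p z) * (E i (\<phi> p y) * E i (\<xi> p))
      + (\<alpha> * \<beta> - \<alpha>) * (E i z * E i (\<phi> p y))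
      + (\<beta>\<^sup>2 - 2 * \<beta>) * (E i (\<phi> p z) * E i (\<phi> p y))
      + (\<alpha> * \<beta> - \<alpha>) * (E i (\<phi> p z) * E i y)
      + \<alpha>\<^sup>2 * (E i z * E i y)" if "i \<in> {0..2*n}" for i
  proof -
    have eT: "e i \<in> T p" using frame_T[OF e] that by simp
    have ee: "g p (e i) (e i) = 1" using frame_orthonormal[OF e, of i i] that by simp
    have ye: "g p y (e i) = E i y" and ye': "g p y (\<phi> p (e i)) = E i (\<phi> p y)"
      using g_commute[OF y eT] g_commute[of "\<phi> p y" p "e i"] y eT by (simp_all add: E_def)
    show ?thesis
      unfolding curvature_difference_def ye ye' ee P_def Q_def
      using y z eT by (simp add: E_def algebra_simps power2_eq_square)
  qed
  then have "(\<Sum>i=0..2*n. curvature_difference p (e i) y z (e i)) =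
      (2 * real n + 1) * (\<beta> * \<eta> p y * \<eta> p z + \<alpha> * g p y (\<phi> p z) - \<alpha> * Q)
      + (\<beta> * g p y z + \<alpha> * P) * g p (\<xi> p) (\<xi> p)
      + (- (\<beta> + \<alpha>\<^sup>2) * \<eta> p y) * g p z (\<xi> p)
      + (- (\<beta> + \<alpha>\<^sup>2) * \<eta> p z) * g p y (\<xi> p)
      + (- \<alpha> * \<beta> * \<eta> p y) * g p (\<phi> p z) (\<xi> p)
      + (- \<alpha> * \<beta> * \<eta> p z) * g p (\<phi> p y) (\<xi> p)
      + (\<alpha> * \<beta> - \<alpha>) * g p z (\<phi> p y)
      + (\<beta>\<^sup>2 - 2 * \<beta>) * g p (\<phi> p z) (\<phi> p y)
      + (\<alpha> * \<beta> - \<alpha>) * g p (\<phi> p z) y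
      + \<alpha>\<^sup>2 * g p z y"
    using y z by (simp only: sum.distrib sum_distrib_left[symmetric] EE F phi_T xi_T cong: sum.cong) simp
  moreover have "g p z (\<phi> p y) = g p y (\<phi> p z)" "g p z y = g p y z"
    using g_commute[OF z y] g_commute[of "\<phi> p z" p y] y z by simp_all
  ultimately show ?thesis
    using y z by (simp add: P_def Q_def algebra_simps power2_eq_square)
qed

text \<open>The chosen frame and extensions are the same for both connections, so the sums differ by
  the trace of \<open>curvature_difference\<close>.\<close>

lemma ricci_D':
  assumes X: "X \<in> VF" and Y: "Y \<in> VF"
  shows "ricci n A \<xi> g D' X Y p = ricci n A \<xi> g D X Y p
      + ((1 - 2 * real n) * \<alpha>\<^sup>2 + \<beta>\<^sup>2 - \<beta>) * g p (X p) (Y p)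
      + ((2 * real n - 1) * \<alpha> + (2 - 2 * real n) * \<alpha> * \<beta>) * g p (X p) (\<phi> p (Y p))
      + ((2 * real n + 1) * \<beta> + (2 * real n - 1) * \<alpha>\<^sup>2 - \<beta>\<^sup>2) * (\<eta> p (X p) * \<eta> p (Y p))"
proof -
  define e where "e = (SOME e. adapted_orthonormal_basis n A \<xi> g p e)"
  have e: "adapted_orthonormal_basis n A \<xi> g p e"
    unfolding e_def using adapted_orthonormal_basis_exists by (rule someI_ex)
  have "curvature_tensor g D' (extension A p (e i)) X Y (extension A p (e i)) p
      = curvature_tensor g D (extension A p (e i)) X Y (extension A p (e i)) p
        + curvature_difference p (e i) (X p) (Y p) (e i)" if "i \<in> {0..2*n}" for i
  proof -
    have eT: "e i \<in> T p" using frame_T[OF e] that by simp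
    show ?thesis
      using curvature_D'[OF extension_vector_field(1)[OF eT] X Y eT] extension_vector_field(2)[OF eT]
      by (simp add: curvature_tensor_def)
  qed
  then have "ricci n A \<xi> g D' X Y p = ricci n A \<xi> g D X Y p
      + (\<Sum>i=0..2*n. curvature_difference p (e i) (X p) (Y p) (e i))"
    by (simp add: ricci_def Let_def e_def[symmetric] sum.distrib)
  then show ?thesis
    using trace_curvature_difference[OF e VF_T[OF X] VF_T[OF Y]] by simp
qed

text \<open>D'_X \<xi> differs from D_X \<xi> by \<alpha> \<eta>(X) \<xi> - P X, a self-adjoint
  expression in X, so both halves change equally.\<close>

lemma lie_derivative_D':
  assumes X: "X \<in> VF" and Y: "Y \<in> VF"
  shows "lie_derivative_metric \<xi> g D' X Y p = lie_derivative_metric \<xi> g D X Y p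
    - 2 * \<beta> * g p (X p) (\<phi> p (Y p)) - 2 * \<alpha> * (g p (X p) (Y p) - \<eta> p (X p) * \<eta> p (Y p))"
  using X Y by (simp add: lie_derivative_metric_def D'_apply algebra_simps)

end

end

theorem theorem8:
  fixes A :: "('m::{t2_space, second_countable_topology}, 'e::euclidean_space) chart set"
    and \<phi> :: "'m \<Rightarrow> 'm tangent_vector \<Rightarrow> 'm tangent_vector"
    and \<xi> :: "'m vector_field"
    and \<eta> :: "'m \<Rightarrow> 'm tangent_vector \<Rightarrow> real"
    and g :: "'m \<Rightarrow> 'm tangent_vector \<Rightarrow> 'm tangent_vector \<Rightarrow> real"
    and D :: "'m connection"
    and n :: nat
    and \<alpha> \<beta> a b c :: real
  assumes "levi_civita_connection A g D"
    and "para_Sasaki_like n A \<phi> \<xi> \<eta> g D"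
    and "para_Ricci_like_soliton n A \<phi> \<xi> \<eta> g D a b c"
  shows "para_Ricci_like_soliton n A \<phi> \<xi> \<eta> g
           (generalized_symmetric_connection \<phi> \<xi> \<eta> g D \<alpha> \<beta>)
           ((2 * real n - 1) * \<alpha>^2 - \<beta>^2 + \<alpha> + \<beta> + a)
           (2 * (real n - 1) * \<alpha> * \<beta> + (1 - 2 * real n) * \<alpha> + \<beta> + b)
           (\<beta>^2 + (1 - 2 * real n) * \<alpha>^2 + (\<alpha> - \<alpha> * \<beta>) * (2 * real n - 2)
              - (2 * real n + 2) * \<beta> + c)"
proof -
  interpret para_Sasaki_manifold A \<phi> \<xi> \<eta> g D n
    using assms(1,2) by unfold_locales
  show ?thesis
    unfolding para_Ricci_like_soliton_def
  proof (intro ballI allI)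
    fix X Y p assume X: "X \<in> vector_fields A" and Y: "Y \<in> vector_fields A"
    have "(1 / 2) * lie_derivative_metric \<xi> g D X Y p + ricci n A \<xi> g D X Y p
        + a * g p (X p) (Y p) + b * associated_metric \<phi> \<eta> g p (X p) (Y p)
        + c * (\<eta> p (X p) * \<eta> p (Y p)) = 0"
      using assms(3) X Y by (simp add: para_Ricci_like_soliton_def)
    then show "(1 / 2) * lie_derivative_metric \<xi> g (generalized_symmetric_connection \<phi> \<xi> \<eta> g D \<alpha> \<beta>) X Y p
        + ricci n A \<xi> g (generalized_symmetric_connection \<phi> \<xi> \<eta> g D \<alpha> \<beta>) X Y p
        + ((2 * real n - 1) * \<alpha>^2 - \<beta>^2 + \<alpha> + \<beta> + a) * g p (X p) (Y p)
        + (2 * (real n - 1) * \<alpha> * \<beta> + (1 - 2 * real n) * \<alpha> + \<beta> + b)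
          * associated_metric \<phi> \<eta> g p (X p) (Y p)
        + (\<beta>^2 + (1 - 2 * real n) * \<alpha>^2 + (\<alpha> - \<alpha> * \<beta>) * (2 * real n - 2)
              - (2 * real n + 2) * \<beta> + c) * (\<eta> p (X p) * \<eta> p (Y p)) = 0"
      \<comment> \<open>Half the change of the Lie derivative plus the change of Ricci, negated,
        gives the corrections to a and b. As the associated metric contains the square of \<eta>,
        \<nu> also absorbs - (\<mu> - b): this turns (2 n + 1) \<beta> into (2 n + 2) \<beta> and
        produces (\<alpha> - \<alpha> \<beta>) (2 n - 2).\<close>
      unfolding ricci_D'[OF X Y] lie_derivative_D'[OF X Y] associated_metric_def
      by (simp add: algebra_simps)
  qed
qed

end
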